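(* Let $k\ge2$ and $s,r\ge3$ be integers with $(s,r)\in\{(3,3),(3,4),(3,5),(4,3),(5,3)\}$, and let $u$ be a totally real algebraic integer with $2<u<14$. Consider the $4\times4$ symmetric matrix $A$ indexed by $e_1,\dots,e_4$ with diagonal entries $-2$ and off-diagonal entries $a_{12}=u$, $a_{13}=2\cos\frac{\pi}{s}$, $a_{23}=2\cos\frac{\pi}{k}$, $a_{14}=2\cos\frac{\pi}{r}$, $a_{24}=a_{34}=0$. Assume $A$ is V-arithmetic with ground field $\mathbb K$. Then: $[\mathbb K:\mathbb Q]\le16$ for $k=2$, $s=r=3$; $[\mathbb K:\mathbb Q]\le8$ for $k=2$, $(s,r)\in\{(3,4),(4,3)\}$; $[\mathbb K:\mathbb Q]\le10$ for $k=2$, $(s,r)\in\{(3,5),(5,3)\}$; $[\mathbb K:\mathbb Q]\le25$ for $r=k=3$; $[\mathbb K:\mathbb Q]\le21$ for $r=3,k=7$; $[\mathbb K:\mathbb Q]\le20$ for all remaining $k,s,r$. In particular $[\mathbb K:\mathbb Q]\le25$ always.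
   Context: A fundamental matrix is a real symmetric matrix $A=(a_{ij})$ with $a_{ii}=-2$, $a_{ij}\ge0$ for $i\ne j$, and $a_{ij}=2\cos(\pi/m_{ij})$ for an integer $m_{ij}\ge2$ whenever $a_{ij}<2$ (note $2\cos(\pi/2)=0$). It is hyperbolic if it has exactly one positive eigenvalue. Its cyclic products are $a_{i_1i_2}a_{i_2i_3}\cdots a_{i_ki_1}$; its ground field $\mathbb K$ is the field generated over $\mathbb Q$ by all cyclic products. A hyperbolic fundamental matrix is V-arithmetic if all cyclic products are algebraic integers, the field $\mathbb Q(\{a_{ij}\})$ is totally real, and for every embedding $\varphi:\mathbb Q(\{a_{ij}\})\to\mathbb R$ whose restriction to $\mathbb K$ is not the identity inclusion, the matrix $(\varphi(a_{ij}))$ is negative definite. All fields are regarded as subfields of $\mathbb R$. *)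

theory Defs
  imports "Jordan_Normal_Form.Char_Poly"
begin

definition alg_int :: "real \<Rightarrow> bool" where
  "alg_int x \<longleftrightarrow> (\<exists>p :: int poly. lead_coeff p = 1 \<and> poly (map_poly of_int p) x = 0)"

definition is_subfield :: "real set \<Rightarrow> bool" where
  "is_subfield F \<longleftrightarrow> 0 \<in> F \<and> 1 \<in> F \<and>
     (\<forall>x\<in>F. \<forall>y\<in>F. x + y \<in> F \<and> x * y \<in> F) \<and>
     (\<forall>x\<in>F. - x \<in> F \<and> inverse x \<in> F)"

definition gen_field :: "real set \<Rightarrow> real set" where
  "gen_field S = \<Inter>{F. is_subfield F \<and> S \<subseteq> F}"

(* ring homomorphism (unital) defined on a subfield F; for F a field this is a field embedding *)
definition hom_on :: "real set \<Rightarrow> (real \<Rightarrow> 'b :: comm_ring_1) \<Rightarrow> bool" where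
  "hom_on F \<phi> \<longleftrightarrow> \<phi> 1 = 1 \<and>
     (\<forall>x\<in>F. \<forall>y\<in>F. \<phi> (x + y) = \<phi> x + \<phi> y \<and> \<phi> (x * y) = \<phi> x * \<phi> y)"

definition totally_real :: "real set \<Rightarrow> bool" where
  "totally_real F \<longleftrightarrow> (\<forall>\<phi> :: real \<Rightarrow> complex. hom_on F \<phi> \<longrightarrow> (\<forall>x\<in>F. Im (\<phi> x) = 0))"

definition qspan :: "real set \<Rightarrow> real set" where
  "qspan B = {x. \<exists>c :: real \<Rightarrow> rat. x = (\<Sum>b\<in>B. of_rat (c b) * b)}"

definition qfinite :: "real set \<Rightarrow> bool" where
  "qfinite F \<longleftrightarrow> (\<exists>B. finite B \<and> B \<subseteq> F \<and> F \<subseteq> qspan B)"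

definition qdegree :: "real set \<Rightarrow> nat" where
  "qdegree F = (LEAST n. \<exists>B. finite B \<and> card B = n \<and> B \<subseteq> F \<and> F \<subseteq> qspan B)"

definition fundamental :: "real mat \<Rightarrow> bool" where
  "fundamental A \<longleftrightarrow> (\<exists>n. A \<in> carrier_mat n n \<and>
     (\<forall>i<n. \<forall>j<n. A $$ (i,j) = A $$ (j,i)) \<and>
     (\<forall>i<n. A $$ (i,i) = -2) \<and>
     (\<forall>i<n. \<forall>j<n. i \<noteq> j \<longrightarrow> A $$ (i,j) \<ge> 0 \<and>
        (A $$ (i,j) < 2 \<longrightarrow> (\<exists>m::nat. m \<ge> 2 \<and> A $$ (i,j) = 2 * cos (pi / real m)))))"

definition hyperbolic :: "real mat \<Rightarrow> bool" where
  "hyperbolic A \<longleftrightarrow>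
     (\<Sum>x\<in>{x. x > 0 \<and> poly (char_poly A) x = 0}. order x (char_poly A)) = 1"

definition neg_definite :: "real mat \<Rightarrow> bool" where
  "neg_definite A \<longleftrightarrow> (\<forall>v \<in> carrier_vec (dim_row A). v \<noteq> 0\<^sub>v (dim_row A) \<longrightarrow> v \<bullet> (A *\<^sub>v v) < 0)"

definition entries :: "real mat \<Rightarrow> real set" where
  "entries A = {A $$ (i,j) | i j. i < dim_row A \<and> j < dim_col A}"

definition cyclic_products :: "real mat \<Rightarrow> real set" where
  "cyclic_products A = {(\<Prod>j<k. A $$ (idx j, idx (Suc j mod k))) | k idx.
       k \<ge> 1 \<and> (\<forall>j<k. idx j < dim_row A)}"

definition ground_field :: "real mat \<Rightarrow> real set" where
  "ground_field A = gen_field (cyclic_products A)"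

definition V_arithmetic :: "real mat \<Rightarrow> bool" where
  "V_arithmetic A \<longleftrightarrow> fundamental A \<and> hyperbolic A \<and>
     (\<forall>c \<in> cyclic_products A. alg_int c) \<and>
     totally_real (gen_field (entries A)) \<and>
     (\<forall>\<phi> :: real \<Rightarrow> real. hom_on (gen_field (entries A)) \<phi> \<and>
         (\<exists>x \<in> ground_field A. \<phi> x \<noteq> x) \<longrightarrow> neg_definite (map_mat \<phi> A))"

end

theory Submission
  imports Defs "HOL-Computational_Algebra.Polynomial_Factorial"
    "HOL-Computational_Algebra.Field_as_Ring"
begin

text \<open>
  Write \<open>a, b, c\<close> for the entries \<open>a\<^sub>1\<^sub>3, a\<^sub>2\<^sub>3, a\<^sub>1\<^sub>4\<close> and put \<open>t = u\<^sup>2 + u a b\<close>, \<open>p = b\<^sup>2\<close>,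
  \<open>D = 4 - a\<^sup>2 - c\<^sup>2\<close>; these are integers of the ground field \<open>K\<close>. At every embedding that is not the
  identity on \<open>K\<close>, negative definiteness confines \<open>(p, t)\<close> to the triangle
  \<open>0 \<le> 4 t + a\<^sup>2 p < D (4 - p)\<close>, \<open>0 \<le> p < 4\<close>. In each case there is a polynomial \<open>W(t, p, D)\<close> with
  integer coefficients that is bounded on this triangle by some \<open>\<kappa> < 1\<close>. The norm of the nonzero
  integer \<open>W\<close> is at least \<open>1\<close> in absolute value, so \<open>1 \<le> \<bar>W\<bar> \<kappa>^(n - 1)\<close> where \<open>n\<close> is the degree of \<open>K\<close>;
  since \<open>u < 14\<close> bounds \<open>W\<close>, this bounds \<open>n\<close>.

  The polynomials for arbitrary \<open>k\<close> are \<open>T\<^sup>2 (T + 1)\<close> with \<open>T = t (t + p - 2)\<close> for \<open>s = r = 3\<close>,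
  where \<open>-1 \<le> T \<le> 1/3\<close>, and products of linear forms whose zero lines meet the triangle in a
  symmetric configuration in the other cases.
\<close>

section \<open>Algebraic integers\<close>

text \<open>The field L generated by the entries may be larger than K, and the hypothesis speaks of
  embeddings of L. The norm is therefore taken from L: each embedding fixing K contributes the
  factor \<bar>W\<bar>, every other one at most \<kappa>, and a count of the embeddings fixing K
  turns the resulting exponent into one for K. The degree of 2 cos(pi/k) grows without bound with k,
  so p is kept as a free coordinate and W must be small on the whole triangle. This yields 20 for
  every k, which includes the claims 25 and 21. For k = 2 the triangle shrinks to its edge p = 0, an
  interval for t, where polynomials built from y (1 - y) with maximum 1/4 give the smaller bounds.
  At the identity t > 4, far outside the triangle, which keeps W away from 0. If s or r is 5, D is a
  quadratic irrationality and an embedding can enlarge it from about 0.38 to about 2.62. Hence D is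
  an argument of W, and powers of the unit 3 - D = 1/D even out the two triangles.\<close>

definition int_span :: "'a::field_char_0 set \<Rightarrow> 'a set" where
  "int_span G = {\<Sum>g\<in>G. of_int (c g) * g | c. True}"

lemma int_span_zero: "0 \<in> int_span G"
  unfolding int_span_def by (rule CollectI, rule exI[of _ "\<lambda>_. 0"]) simp

lemma int_span_add:
  assumes "x \<in> int_span G" "y \<in> int_span G" shows "x + y \<in> int_span G"
proof -
  obtain c d where "x = (\<Sum>g\<in>G. of_int (c g) * g)" "y = (\<Sum>g\<in>G. of_int (d g) * g)"
    using assms unfolding int_span_def by blast
  then have "x + y = (\<Sum>g\<in>G. of_int (c g + d g) * g)"
    by (simp add: sum.distrib distrib_right)
  then show ?thesis unfolding int_span_def by (intro CollectI exI[of _ "\<lambda>g. c g + d g"]) simp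
qed

lemma int_span_scale:
  assumes "x \<in> int_span G" shows "of_int n * x \<in> int_span G"
proof -
  obtain c where "x = (\<Sum>g\<in>G. of_int (c g) * g)"
    using assms unfolding int_span_def by blast
  then have "of_int n * x = (\<Sum>g\<in>G. of_int (n * c g) * g)"
    by (simp add: sum_distrib_left mult.assoc)
  then show ?thesis unfolding int_span_def by (intro CollectI exI[of _ "\<lambda>g. n * c g"]) simp
qed

lemma int_span_sum: "(\<And>i. i \<in> I \<Longrightarrow> f i \<in> int_span G) \<Longrightarrow> sum f I \<in> int_span G"
  by (induction I rule: infinite_finite_induct) (auto intro: int_span_zero int_span_add)

lemma int_span_base:
  assumes "finite G" "g \<in> G" shows "g \<in> int_span G"
proof -
  have "(\<Sum>h\<in>G. of_int (if h = g then 1 else 0) * h) = (\<Sum>h\<in>G. if h = g then g else 0)"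
    by (intro sum.cong) auto
  also have "\<dots> = g" using assms by simp
  finally show ?thesis unfolding int_span_def by (intro CollectI exI[of _ "\<lambda>h. if h = g then 1 else 0"]) simp
qed

lemma int_span_mult:
  assumes "finite G" "\<And>g. g \<in> G \<Longrightarrow> x * g \<in> int_span G" "y \<in> int_span G"
  shows "x * y \<in> int_span G"
proof -
  obtain c where "y = (\<Sum>g\<in>G. of_int (c g) * g)"
    using assms(3) unfolding int_span_def by blast
  then have "x * y = (\<Sum>g\<in>G. of_int (c g) * (x * g))"
    by (simp add: sum_distrib_left mult.left_commute)
  then show ?thesis using assms by (auto intro: int_span_sum int_span_scale)
qed

text \<open>Multiplication by \<open>x\<close> acts on the generators by an integer matrix, of which \<open>x\<close> is an
  eigenvalue.\<close>

lemma algebraic_int_if_stable: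
  fixes x :: "'a::field_char_0"
  assumes fin: "finite G" and one: "1 \<in> G" and st: "\<And>g. g \<in> G \<Longrightarrow> x * g \<in> int_span G"
  shows "algebraic_int x"
proof -
  define n where "n = card G"
  obtain e where e: "bij_betw e {0..<n} G"
    using ex_bij_betw_nat_finite[OF fin] n_def by auto
  have "\<forall>g\<in>G. \<exists>c. x * g = (\<Sum>h\<in>G. of_int (c h) * h)"
    using st unfolding int_span_def by blast
  then obtain c where c: "\<And>g. g \<in> G \<Longrightarrow> x * g = (\<Sum>h\<in>G. of_int (c g h :: int) * h)"
    by metis
  define M where "M = mat n n (\<lambda>(i,j). c (e i) (e j))"
  define N where "N = (map_mat of_int M :: 'a mat)"
  define v where "v = vec n e"
  have M: "M \<in> carrier_mat n n" and N: "N \<in> carrier_mat n n" by (auto simp: M_def N_def)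
  have v: "v \<in> carrier_vec n" by (simp add: v_def)
  have eG: "e i \<in> G" if "i < n" for i using e that by (auto simp: bij_betw_def)
  have "v \<noteq> 0\<^sub>v n"
  proof -
    obtain i where "i < n" "e i = 1" using e one by (auto simp: bij_betw_def image_iff)
    then show ?thesis by (metis index_vec index_zero_vec(1) v_def zero_neq_one)
  qed
  moreover have "N *\<^sub>v v = x \<cdot>\<^sub>v v"
  proof (rule eq_vecI)
    fix i assume "i < dim_vec (x \<cdot>\<^sub>v v)"
    then have i: "i < n" by (simp add: v_def)
    have "(N *\<^sub>v v) $ i = (\<Sum>j\<in>{0..<n}. of_int (c (e i) (e j)) * e j)"
      using i by (auto simp: N_def M_def v_def scalar_prod_def intro!: sum.cong)
    also have "\<dots> = (\<Sum>h\<in>G. of_int (c (e i) h) * h)"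
      by (rule sum.reindex_bij_betw[OF e])
    also have "\<dots> = x * e i" using c[OF eG[OF i]] by simp
    finally show "(N *\<^sub>v v) $ i = (x \<cdot>\<^sub>v v) $ i" using i by (simp add: v_def)
  qed (auto simp: N_def M_def v_def)
  ultimately have "eigenvalue N x"
    unfolding eigenvalue_def eigenvector_def using v N by (auto intro!: exI[of _ v])
  then have "poly (char_poly N) x = 0"
    using eigenvalue_root_char_poly[OF N] by simp
  moreover have "char_poly N = map_poly of_int (char_poly M)"
    unfolding N_def by (rule of_int_hom.char_poly_hom[OF M])
  moreover have "lead_coeff (char_poly M) = 1" using degree_monic_char_poly[OF M] by simp
  ultimately show ?thesis unfolding algebraic_int_altdef_ipoly by auto
qed

lemma algebraic_int_power_reduce:
  fixes x :: "'a::field_char_0"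
  assumes "algebraic_int x"
  obtains a and c :: "nat \<Rightarrow> int" where "a > 0" "x ^ a = (\<Sum>i<a. of_int (c i) * x ^ i)"
proof -
  obtain p where p: "poly (map_poly of_int p) x = 0" "lead_coeff p = 1"
    using assms unfolding algebraic_int_altdef_ipoly by blast
  let ?a = "degree p"
  have "?a > 0"
  proof (rule ccontr)
    assume "\<not> ?a > 0"
    then obtain k where "p = [:k:]" by (auto elim: degree_eq_zeroE)
    with p show False by (simp add: map_poly_pCons)
  qed
  have "0 = (\<Sum>i\<le>?a. of_int (coeff p i) * x ^ i)"
    using p(1) by (simp add: poly_altdef)
  also have "\<dots> = x ^ ?a + (\<Sum>i<?a. of_int (coeff p i) * x ^ i)"
    using p(2) by (simp add: lessThan_Suc_atMost[symmetric])
  finally have "x ^ ?a = (\<Sum>i<?a. of_int (- coeff p i) * x ^ i)"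
    by (simp add: sum_negf eq_neg_iff_add_eq_0)
  with \<open>?a > 0\<close> show ?thesis by (rule that)
qed

text \<open>The lattice spanned by the finitely many \<open>x ^ i * y ^ j\<close> with
  \<open>i < a\<close>, \<open>j < b\<close> is mapped to itself by multiplication with
  \<open>x\<close> and with \<open>y\<close>: only the top exponent leaves the range, and the monic
  relation brings it back. Hence \<open>x + y\<close> and \<open>x * y\<close> act on it
  too.\<close>

lemma
  fixes x y :: "'a::field_char_0"
  assumes "algebraic_int x" "algebraic_int y"
  shows algebraic_int_add: "algebraic_int (x + y)"
    and algebraic_int_mult: "algebraic_int (x * y)"
proof -
  obtain a c where a: "a > 0" "x ^ a = (\<Sum>i<a. of_int (c i) * x ^ i)"
    by (rule algebraic_int_power_reduce[OF assms(1)])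
  obtain b d where b: "b > 0" "y ^ b = (\<Sum>i<b. of_int (d i) * y ^ i)"
    by (rule algebraic_int_power_reduce[OF assms(2)])
  define G where "G = (\<lambda>(i,j). x ^ i * y ^ j) ` ({..<a} \<times> {..<b})"
  have fin: "finite G" by (simp add: G_def)
  have one: "1 \<in> G" unfolding G_def using a(1) b(1)
    by (intro image_eqI[of _ _ "(0,0)"]) auto
  have mem: "x ^ i * y ^ j \<in> int_span G" if "i < a" "j < b" for i j
    using that by (intro int_span_base[OF fin]) (auto simp: G_def)
  have X: "x * g \<in> int_span G" if g: "g \<in> G" for g
  proof -
    obtain i j where ij: "i < a" "j < b" "g = x ^ i * y ^ j" using g by (auto simp: G_def)
    show ?thesis
    proof (cases "Suc i < a")
      case True then show ?thesis using mem[of "Suc i" j] ij by (simp add: mult.assoc)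
    next
      case False
      then have "x * g = x ^ a * y ^ j"
        using ij by (metis Suc_lessI mult.assoc power_Suc)
      also have "\<dots> = (\<Sum>l<a. of_int (c l) * (x ^ l * y ^ j))"
        by (simp add: a(2) sum_distrib_right mult.assoc)
      finally show ?thesis using mem ij by (auto intro!: int_span_sum int_span_scale)
    qed
  qed
  have Y: "y * g \<in> int_span G" if g: "g \<in> G" for g
  proof -
    obtain i j where ij: "i < a" "j < b" "g = x ^ i * y ^ j" using g by (auto simp: G_def)
    show ?thesis
    proof (cases "Suc j < b")
      case True then show ?thesis using mem[of i "Suc j"] ij by (simp add: mult.left_commute)
    next
      case False
      then have "y * g = x ^ i * y ^ b"
        using ij by (metis Suc_lessI mult.left_commute power_Suc)
      also have "\<dots> = (\<Sum>l<b. of_int (d l) * (x ^ i * y ^ l))"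
        by (simp add: b(2) sum_distrib_left mult.left_commute)
      finally show ?thesis using mem ij by (auto intro!: int_span_sum int_span_scale)
    qed
  qed
  show "algebraic_int (x + y)"
    by (rule algebraic_int_if_stable[OF fin one]) (auto simp: distrib_right intro: int_span_add X Y)
  show "algebraic_int (x * y)"
    by (rule algebraic_int_if_stable[OF fin one])
      (auto simp: mult.assoc intro: int_span_mult[OF fin] X Y)
qed

lemma algebraic_int_diff:
  fixes x y :: "'a::field_char_0"
  shows "algebraic_int x \<Longrightarrow> algebraic_int y \<Longrightarrow> algebraic_int (x - y)"
  using algebraic_int_add[of x "- y"] by simp

lemma algebraic_int_power:
  fixes x :: "'a::field_char_0"
  shows "algebraic_int x \<Longrightarrow> algebraic_int (x ^ n)"
  by (induction n) (auto intro: algebraic_int_mult)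

lemma algebraic_int_prod:
  fixes f :: "'b \<Rightarrow> 'a::field_char_0"
  shows "(\<And>i. i \<in> I \<Longrightarrow> algebraic_int (f i)) \<Longrightarrow> algebraic_int (prod f I)"
  by (induction I rule: infinite_finite_induct) (auto intro: algebraic_int_mult)

lemma alg_int_iff: "alg_int x \<longleftrightarrow> algebraic_int x"
  unfolding alg_int_def algebraic_int_altdef_ipoly by auto

section \<open>Subfields of the reals\<close>

context
  fixes F :: "real set"
  assumes F: "is_subfield F"
begin

lemma subfield_0: "0 \<in> F" and subfield_1: "1 \<in> F"
  and subfield_add: "x \<in> F \<Longrightarrow> y \<in> F \<Longrightarrow> x + y \<in> F"
  and subfield_mult: "x \<in> F \<Longrightarrow> y \<in> F \<Longrightarrow> x * y \<in> F"
  and subfield_minus: "x \<in> F \<Longrightarrow> - x \<in> F"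
  and subfield_inverse: "x \<in> F \<Longrightarrow> inverse x \<in> F"
  using F unfolding is_subfield_def by auto

lemma subfield_diff: "x \<in> F \<Longrightarrow> y \<in> F \<Longrightarrow> x - y \<in> F"
  using subfield_add[of x "- y"] subfield_minus by simp

lemma subfield_divide: "x \<in> F \<Longrightarrow> y \<in> F \<Longrightarrow> x / y \<in> F"
  by (simp add: divide_inverse subfield_mult subfield_inverse)

lemma subfield_power: "x \<in> F \<Longrightarrow> x ^ n \<in> F"
  by (induction n) (auto intro: subfield_1 subfield_mult)

lemma subfield_sum: "(\<And>i. i \<in> I \<Longrightarrow> f i \<in> F) \<Longrightarrow> sum f I \<in> F"
  by (induction I rule: infinite_finite_induct) (auto intro: subfield_0 subfield_add)

lemma subfield_prod: "(\<And>i. i \<in> I \<Longrightarrow> f i \<in> F) \<Longrightarrow> prod f I \<in> F"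
  by (induction I rule: infinite_finite_induct) (auto intro: subfield_1 subfield_mult)

lemma subfield_of_nat: "of_nat n \<in> F"
  by (induction n) (auto intro: subfield_0 subfield_1 subfield_add)

lemma subfield_numeral: "numeral n \<in> F"
  using subfield_of_nat[of "numeral n"] by simp

lemma subfield_of_int: "of_int n \<in> F"
  by (cases n) (auto intro: subfield_of_nat subfield_minus simp del: of_nat_Suc)

lemma subfield_of_rat: "of_rat r \<in> F"
proof (cases r)
  case (Fract a b)
  then show ?thesis by (simp add: of_rat_rat subfield_divide subfield_of_int)
qed

lemmas subfield_intros = subfield_0 subfield_1 subfield_add subfield_mult subfield_minus
  subfield_diff subfield_power subfield_numeral

end

lemma gen_field_subfield: "is_subfield (gen_field S)"
  unfolding gen_field_def is_subfield_def by auto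

lemma gen_field_superset: "S \<subseteq> gen_field S"
  unfolding gen_field_def by auto

lemma gen_field_least: "is_subfield F \<Longrightarrow> S \<subseteq> F \<Longrightarrow> gen_field S \<subseteq> F"
  unfolding gen_field_def by auto

section \<open>Minimal polynomials\<close>

interpretation of_rat_poly_hom: map_poly_inj_idom_hom "of_rat :: rat \<Rightarrow> 'a::field_char_0" ..

text \<open>The target field is left open so that one rational polynomial can be evaluated at a real
  generator and at its complex conjugates.\<close>

definition rpoly :: "rat poly \<Rightarrow> 'a::field_char_0 \<Rightarrow> 'a" where
  "rpoly f x = poly (map_poly of_rat f) x"

lemma rpoly_simps [simp]:
  "rpoly 0 x = 0" "rpoly 1 x = 1" "rpoly (f + g) x = rpoly f x + rpoly g x"
  "rpoly (f - g) x = rpoly f x - rpoly g x" "rpoly (- f) x = - rpoly f x"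
  "rpoly (f * g) x = rpoly f x * rpoly g x" "rpoly (Polynomial.smult c f) x = of_rat c * rpoly f x"
  "rpoly (pCons c f) x = of_rat c + x * rpoly f x"
  by (simp_all add: rpoly_def of_rat_poly_hom.hom_add of_rat_poly_hom.hom_minus
      of_rat_poly_hom.hom_uminus of_rat_poly_hom.hom_mult of_rat_hom.map_poly_pCons_hom
      of_rat_hom.map_poly_hom_smult)

lemma rpoly_pcompose [simp]: "rpoly (f \<circ>\<^sub>p g) x = rpoly f (rpoly g x)"
  by (induction f) (auto simp: pcompose_pCons)

lemma rpoly_of_int: "rpoly (map_poly of_int p) x = poly (map_poly of_int p) x"
  by (simp add: rpoly_def map_poly_map_poly o_def)

lemma of_real_of_rat: "complex_of_real (of_rat r) = of_rat r"
  by (cases r) (simp add: of_rat_rat)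

lemma of_real_rpoly: "complex_of_real (rpoly f x) = rpoly f (complex_of_real x)"
  by (induction f) (auto simp: of_real_of_rat)

lemma rpoly_subfield: "is_subfield F \<Longrightarrow> x \<in> F \<Longrightarrow> rpoly f x \<in> F"
  by (induction f) (auto intro: subfield_0 subfield_add subfield_mult subfield_of_rat)

text \<open>Minimality is recorded as divisibility, which is the form that carries vanishing at
  \<open>x\<close> over to the other roots.\<close>

definition is_minpoly :: "rat poly \<Rightarrow> 'a::field_char_0 \<Rightarrow> bool" where
  "is_minpoly m x \<longleftrightarrow> lead_coeff m = 1 \<and> rpoly m x = 0 \<and> (\<forall>f. rpoly f x = 0 \<longrightarrow> m dvd f)"

lemma minpoly_exists:
  fixes x :: "'a::field_char_0"
  assumes "f \<noteq> 0" "rpoly f x = 0"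
  obtains m where "is_minpoly m x"
proof -
  define P where "P = (\<lambda>f. f \<noteq> 0 \<and> rpoly f x = 0)"
  define h where "h = arg_min degree P"
  have h: "P h" and h_min: "degree h \<le> degree g" if "P g" for g
    using arg_min_nat_lemma[of P f degree] assms that unfolding h_def P_def by auto
  have h: "P h" using assms h unfolding P_def by blast
  define m where "m = Polynomial.smult (inverse (lead_coeff h)) h"
  have dvd: "m dvd g" if "rpoly g x = 0" for g
  proof -
    have "rpoly (g mod h) x = 0"
      using that h by (simp add: P_def minus_div_mult_eq_mod[symmetric])
    then have "g mod h = 0"
      using h_min[of "g mod h"] degree_mod_less'[of h g] h unfolding P_def by fastforce
    then show ?thesis using h by (auto simp: m_def P_def smult_dvd_iff)
  qed
  have "is_minpoly m x"
    unfolding is_minpoly_def using dvd h by (auto simp: m_def P_def)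
  then show ?thesis by (rule that)
qed

lemma algebraic_int_minpoly:
  fixes x :: "'a::field_char_0"
  assumes "algebraic_int x"
  obtains m where "is_minpoly m x"
proof -
  obtain p where p: "poly (map_poly of_int p) x = 0" "lead_coeff p = 1"
    using assms unfolding algebraic_int_altdef_ipoly by blast
  then have "map_poly rat_of_int p \<noteq> 0" by auto
  moreover have "rpoly (map_poly of_int p) x = 0" using p by (simp add: rpoly_of_int)
  ultimately show ?thesis using minpoly_exists that by blast
qed

context
  fixes m :: "rat poly" and x :: "'a::field_char_0"
  assumes m: "is_minpoly m x"
begin

lemma minpoly_nonzero: "m \<noteq> 0"
  using m unfolding is_minpoly_def by auto

lemma minpoly_root: "rpoly m x = 0"
  using m unfolding is_minpoly_def by auto

lemma minpoly_dvd_iff: "m dvd f \<longleftrightarrow> rpoly f x = 0"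
  using m unfolding is_minpoly_def by auto

text \<open>Split \<open>m\<close> as the gcd times a cofactor. The gcd divides \<open>f\<close> and
  does not vanish at \<open>x\<close>, since otherwise \<open>m\<close> would divide it and hence
  \<open>f\<close>. So the cofactor vanishes at \<open>x\<close>, is a multiple of \<open>m\<close>,
  and the gcd is a unit.\<close>

lemma minpoly_bezout:
  assumes "rpoly f x \<noteq> 0"
  obtains g k where "g * f + k * m = 1"
proof -
  let ?d = "gcd f m"
  obtain e where e: "m = ?d * e" by (meson dvdE gcd_dvd2)
  have "rpoly ?d x \<noteq> 0"
    using assms minpoly_dvd_iff dvd_trans[of m ?d f] gcd_dvd1 by blast
  then have "rpoly e x = 0" using minpoly_root by (subst (asm) e) auto
  then obtain h where "e = m * h" using minpoly_dvd_iff by auto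
  then have "m * (?d * h) = m * 1" using e by (metis mult.assoc mult.commute mult_1_right)
  then have "?d * h = 1" using minpoly_nonzero mult_left_cancel by blast
  then have "?d dvd 1" by (metis dvd_triv_left)
  then have "?d = 1" using is_unit_gcd coprime_iff_gcd_eq_1 by blast
  then show ?thesis using that bezout_coefficients_fst_snd[of f m] by metis
qed

text \<open>All roots of \<open>m\<close> satisfy the same rational equations as \<open>x\<close>.
  If \<open>f\<close> vanished at \<open>z\<close> only, the Bezout identity evaluated at
  \<open>z\<close> would read 0 = 1. This is what makes embeddings well defined and lets integrality
  and separability pass between roots.\<close>

lemma minpoly_conjugate:
  fixes z :: "'b::field_char_0"
  assumes z: "rpoly m z = 0"
  shows "rpoly f z = 0 \<longleftrightarrow> rpoly f x = 0"
proof
  assume "rpoly f x = 0"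
  then obtain g where "f = m * g" using minpoly_dvd_iff by auto
  then show "rpoly f z = 0" using z by simp
next
  assume f: "rpoly f z = 0"
  show "rpoly f x = 0"
  proof (rule ccontr)
    assume "rpoly f x \<noteq> 0"
    then obtain g k where "g * f + k * m = 1" by (rule minpoly_bezout)
    then have "rpoly (g * f + k * m) z = 1" by simp
    then show False using f z by simp
  qed
qed

lemma minpoly_degree_pos: "degree m > 0"
proof (rule ccontr)
  assume "\<not> degree m > 0"
  then obtain k where "m = [:k:]" by (auto elim: degree_eq_zeroE)
  then show False using minpoly_nonzero minpoly_root by simp
qed

lemma minpoly_separable:
  fixes z :: "'b::field_char_0"
  assumes "rpoly m z = 0"
  shows "rpoly (pderiv m) z \<noteq> 0"
proof
  assume "rpoly (pderiv m) z = 0"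
  then have "rpoly (pderiv m) x = 0" using minpoly_conjugate[OF assms] by blast
  then have "m dvd pderiv m" using minpoly_dvd_iff by blast
  moreover have "pderiv m \<noteq> 0" using minpoly_degree_pos by (simp add: pderiv_eq_0_iff)
  ultimately have "degree m \<le> degree (pderiv m)" by (rule dvd_imp_degree_le)
  then show False using minpoly_degree_pos by (simp add: degree_pderiv)
qed

end

lemma pderiv_double_root: "poly (pderiv ([:- b, 1:] * ([:- b, 1:] * q))) b = 0"
  for b :: "'a::field_char_0"
  by (simp only: pderiv_mult poly_mult poly_add) simp

lemma map_poly_of_rat_pderiv:
  "map_poly of_rat (pderiv f) = pderiv (map_poly of_rat f :: 'a::field_char_0 poly)"
  by (rule poly_eqI) (simp add: coeff_pderiv coeff_map_poly of_rat_mult of_rat_add)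

section \<open>The primitive element theorem\<close>

text \<open>This is the ring Q[x], which coincides with the field Q(x) once \<open>x\<close> is
  algebraic.\<close>

definition rat_adjoin :: "real \<Rightarrow> real set" where
  "rat_adjoin x = range (\<lambda>f. rpoly f x)"

lemma rat_adjoin_subfield:
  assumes m: "is_minpoly m x"
  shows "is_subfield (rat_adjoin x)"
proof -
  have inv: "\<exists>g. inverse (rpoly f x) = rpoly g x" for f
  proof (cases "rpoly f x = 0")
    case True then show ?thesis by (auto intro: exI[of _ 0])
  next
    case False
    then obtain g k where "g * f + k * m = 1" by (rule minpoly_bezout[OF m])
    then have "rpoly (g * f + k * m) x = 1" by simp
    then have "rpoly g x * rpoly f x = 1" using minpoly_root[OF m] by simp
    then show ?thesis by (metis inverse_unique mult.commute)
  qed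
  have I: "rpoly f x \<in> rat_adjoin x" for f by (auto simp: rat_adjoin_def)
  show ?thesis
    unfolding is_subfield_def
  proof (intro conjI ballI)
    show "0 \<in> rat_adjoin x" "1 \<in> rat_adjoin x" using I[of 0] I[of 1] by auto
  next
    fix y z assume "y \<in> rat_adjoin x" "z \<in> rat_adjoin x"
    then obtain f g where "y = rpoly f x" "z = rpoly g x" by (auto simp: rat_adjoin_def)
    then show "y + z \<in> rat_adjoin x" "y * z \<in> rat_adjoin x" using I[of "f + g"] I[of "f * g"] by auto
  next
    fix y assume "y \<in> rat_adjoin x"
    then obtain f where "y = rpoly f x" by (auto simp: rat_adjoin_def)
    then show "- y \<in> rat_adjoin x" "inverse y \<in> rat_adjoin x"
      using I[of "- f"] inv[of f] I by auto
  qed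
qed

lemma rat_adjoin_self: "x \<in> rat_adjoin x"
proof -
  have "x = rpoly [:0, 1:] x" by simp
  then show ?thesis unfolding rat_adjoin_def by blast
qed

lemma rat_adjoin_least: "is_subfield F \<Longrightarrow> x \<in> F \<Longrightarrow> rat_adjoin x \<subseteq> F"
  unfolding rat_adjoin_def using rpoly_subfield by auto

section \<open>Polynomials with coefficients in a subfield\<close>

definition polys_over :: "real set \<Rightarrow> real poly set" where
  "polys_over F = {p. \<forall>i. coeff p i \<in> F}"

context
  fixes F :: "real set"
  assumes F: "is_subfield F"
begin

lemma polys_over_add: "p \<in> polys_over F \<Longrightarrow> q \<in> polys_over F \<Longrightarrow> p + q \<in> polys_over F"
  by (auto simp: polys_over_def subfield_add[OF F])

lemma polys_over_diff: "p \<in> polys_over F \<Longrightarrow> q \<in> polys_over F \<Longrightarrow> p - q \<in> polys_over F"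
  by (auto simp: polys_over_def subfield_diff[OF F])

lemma polys_over_mult: "p \<in> polys_over F \<Longrightarrow> q \<in> polys_over F \<Longrightarrow> p * q \<in> polys_over F"
  by (auto simp: polys_over_def coeff_mult intro!: subfield_sum[OF F] subfield_mult[OF F])

lemma polys_over_monom: "c \<in> F \<Longrightarrow> monom c n \<in> polys_over F"
  by (auto simp: polys_over_def subfield_0[OF F])

lemma polys_over_const: "c \<in> F \<Longrightarrow> [:c:] \<in> polys_over F"
  using polys_over_monom[of c 0] by (simp add: monom_0)

lemma polys_over_of_rat: "map_poly of_rat f \<in> polys_over F"
  by (auto simp: polys_over_def coeff_map_poly subfield_of_rat[OF F])

lemma polys_over_pcompose:
  assumes q: "q \<in> polys_over F"
  shows "p \<in> polys_over F \<Longrightarrow> p \<circ>\<^sub>p q \<in> polys_over F"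
proof (induction p)
  case 0 then show ?case by simp
next
  case (pCons a p)
  have cf: "coeff (pCons a p) i \<in> F" for i using pCons.prems unfolding polys_over_def by blast
  have a: "a \<in> F" using cf[of 0] by simp
  have "coeff p i \<in> F" for i using cf[of "Suc i"] by simp
  then have "p \<in> polys_over F" by (simp add: polys_over_def)
  then show ?case using pCons.IH a q
    by (auto simp: pcompose_pCons intro!: polys_over_add polys_over_mult polys_over_const)
qed

text \<open>Polynomials over \<open>F\<close> form a set and not a type, so division with remainder
  is done by hand: subtracting a monomial multiple of \<open>h\<close> cancels the leading term and
  stays over \<open>F\<close>, because the quotient of leading coefficients lies in
  \<open>F\<close>.\<close>

lemma minimal_poly_over_dvd:
  assumes h: "h \<in> polys_over F" "h \<noteq> 0" "poly h b = 0"
    and min: "\<And>p. p \<in> polys_over F \<Longrightarrow> p \<noteq> 0 \<Longrightarrow> poly p b = 0 \<Longrightarrow> degree h \<le> degree p"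
  shows "p \<in> polys_over F \<Longrightarrow> poly p b = 0 \<Longrightarrow> h dvd p"
proof (induction "degree p" arbitrary: p rule: less_induct)
  case less
  show ?case
  proof (cases "p = 0")
    case False
    then have le: "degree h \<le> degree p" using min less.prems by blast
    define q where "q = monom (lead_coeff p / lead_coeff h) (degree p - degree h) * h"
    have lc: "lead_coeff p / lead_coeff h \<in> F"
      using h(1) less.prems(1) by (auto simp: polys_over_def intro: subfield_divide[OF F])
    have q: "q \<in> polys_over F" "poly q b = 0"
      using h lc by (auto simp: q_def intro: polys_over_mult polys_over_monom)
    have dq: "degree q = degree p"
      using h(2) False le by (simp add: q_def degree_mult_eq degree_monom_eq)
    have lq: "coeff q (degree p) = lead_coeff p"
      using h(2) le unfolding q_def by (simp add: coeff_monom_mult)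
    have "h dvd p - q"
    proof (cases "p - q = 0")
      case False
      have "degree (p - q) < degree p"
      proof -
        have "degree (p - q) \<le> degree p" using dq by (simp add: degree_diff_le)
        moreover have "coeff (p - q) (degree p) = 0" using lq by simp
        then have "degree (p - q) \<noteq> degree p" using False leading_coeff_0_iff[of "p - q"] by auto
        ultimately show ?thesis by linarith
      qed
      then show ?thesis using less.hyps[of "p - q"] less.prems q by (auto intro: polys_over_diff)
    qed simp
    moreover have "h dvd q" by (simp add: q_def)
    ultimately show ?thesis by (metis diff_add_cancel dvd_add)
  qed simp
qed

end

interpretation of_real_poly_hom: map_poly_inj_idom_hom complex_of_real ..

lemma poly_of_real_pcompose:
  "poly (map_poly complex_of_real (p \<circ>\<^sub>p q)) z = poly (map_poly of_real p) (poly (map_poly of_real q) z)"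
  by (induction p) (auto simp: pcompose_pCons of_real_poly_hom.hom_add of_real_poly_hom.hom_mult
      of_real_hom.map_poly_pCons_hom)

lemma poly_of_real_map: "poly (map_poly complex_of_real p) (complex_of_real x) = complex_of_real (poly p x)"
  by (induction p) auto

lemma rpoly_via_real: "poly (map_poly complex_of_real (map_poly of_rat f)) z = rpoly f z"
  by (simp add: rpoly_def map_poly_map_poly o_def of_real_of_rat)

text \<open>With \<theta> = a + c b, the minimal polynomial of \<open>b\<close> over Q(\<theta>)
  divides both \<open>mb\<close> and \<open>ma\<close> composed with \<theta> - c X. A suitable
  \<open>c\<close> leaves \<open>b\<close> as their only common complex root, and separability of
  \<open>mb\<close> makes it a simple one. So that polynomial is linear, and its coefficients
  exhibit \<open>b\<close> as an element of Q(\<theta>).\<close>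

lemma primitive_pair:
  fixes a b :: real
  assumes "algebraic_int a" "algebraic_int b"
  obtains c :: nat where "b \<in> rat_adjoin (a + of_nat c * b)"
proof -
  obtain ma where ma: "is_minpoly ma a" using assms(1) by (rule algebraic_int_minpoly)
  obtain mb where mb: "is_minpoly mb b" using assms(2) by (rule algebraic_int_minpoly)
  define R where "R m = {z::complex. rpoly m z = 0}" for m
  have finR: "finite (R m)" if "m \<noteq> 0" for m
    using that unfolding R_def rpoly_def by (intro poly_roots_finite) simp
  \<comment> \<open>A second common root \<beta> with \<theta> - c \<beta> = \<alpha> would force c
    = (\<alpha> - a) / (b - \<beta>). These are finitely many values; pairs with \<beta> = b only
    add the harmless value 0.\<close>
  define bad where "bad = (\<lambda>(\<alpha>, \<beta>). (\<alpha> - of_real a) / (of_real b - \<beta>)) ` (R ma \<times> R mb)"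
  have "finite bad"
    unfolding bad_def using finR minpoly_nonzero[OF ma] minpoly_nonzero[OF mb] by auto
  moreover have "infinite (range (of_nat :: nat \<Rightarrow> complex))"
    by (simp add: finite_image_iff inj_of_nat)
  ultimately obtain c :: nat where c: "of_nat c \<notin> bad"
    by (metis (no_types) finite_subset image_subsetI)
  define \<theta> where "\<theta> = a + of_nat c * b"
  have "algebraic_int \<theta>"
    unfolding \<theta>_def using assms by (auto intro: algebraic_int_add algebraic_int_mult)
  then obtain mt where "is_minpoly mt \<theta>" by (rule algebraic_int_minpoly)
  then have F: "is_subfield (rat_adjoin \<theta>)" by (rule rat_adjoin_subfield)
  define P where "P = (\<lambda>h. h \<in> polys_over (rat_adjoin \<theta>) \<and> h \<noteq> 0 \<and> poly h b = 0)"
  define h where "h = arg_min degree P"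
  have mbP: "P (map_poly of_rat mb)"
    unfolding P_def using polys_over_of_rat[OF F] minpoly_nonzero[OF mb] minpoly_root[OF mb]
    by (simp add: rpoly_def)
  have Ph: "P h" and h_min: "\<And>g. P g \<Longrightarrow> degree h \<le> degree g"
    using arg_min_nat_lemma[of P, OF mbP, of degree] unfolding h_def by auto
  have h: "h \<in> polys_over (rat_adjoin \<theta>)" "h \<noteq> 0" "poly h b = 0" using Ph by (auto simp: P_def)
  have dvd: "h dvd p" if "p \<in> polys_over (rat_adjoin \<theta>)" "poly p b = 0" for p
    using minimal_poly_over_dvd[OF F h _ that] h_min unfolding P_def by blast
  define p2 where "p2 = map_poly of_rat ma \<circ>\<^sub>p [:\<theta>, - of_nat c:]"
  have lin: "[:\<theta>, - of_nat c:] \<in> polys_over (rat_adjoin \<theta>)"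
    by (auto simp: polys_over_def coeff_pCons split: nat.splits
        intro: rat_adjoin_self subfield_0[OF F] subfield_minus[OF F] subfield_of_nat[OF F])
  have hb: "h dvd map_poly of_rat mb" using dvd mbP by (simp add: P_def)
  have hp2: "h dvd p2"
  proof (rule dvd)
    show "p2 \<in> polys_over (rat_adjoin \<theta>)"
      unfolding p2_def by (intro polys_over_pcompose[OF F] lin polys_over_of_rat[OF F])
    show "poly p2 b = 0"
      using minpoly_root[OF ma] by (simp add: p2_def poly_pcompose \<theta>_def rpoly_def mult.commute)
  qed
  have root: "z = of_real b" if z: "poly (map_poly of_real h) z = 0" for z :: complex
  proof (rule ccontr)
    assume ne: "z \<noteq> of_real b"
    have "poly (map_poly of_real (map_poly of_rat mb)) z = 0"
      using hb z by (auto elim!: dvdE simp: of_real_poly_hom.hom_mult)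
    then have zb: "z \<in> R mb" by (simp add: R_def rpoly_via_real)
    have "poly (map_poly complex_of_real p2) z = 0"
      using hp2 z by (auto elim!: dvdE simp: of_real_poly_hom.hom_mult)
    then have "rpoly ma (of_real \<theta> - of_nat c * z) = 0"
      by (simp add: p2_def poly_of_real_pcompose of_real_hom.map_poly_pCons_hom rpoly_via_real mult.commute)
    then have "of_real \<theta> - of_nat c * z \<in> R ma" by (simp add: R_def)
    then have "(of_real \<theta> - of_nat c * z - of_real a) / (of_real b - z) \<in> bad"
      unfolding bad_def using zb by force
    moreover have "(of_real \<theta> - of_nat c * z - of_real a) / (of_real b - z) = of_nat c"
      using ne by (simp add: \<theta>_def field_simps)
    ultimately show False using c by simp
  qed
  obtain h2 where h2: "h = [:-b, 1:] * h2" using h(3) by (auto simp: poly_eq_0_iff_dvd)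
  have "degree h2 = 0"
  proof (rule ccontr)
    assume "degree h2 \<noteq> 0"
    then have "\<not> constant (poly (map_poly complex_of_real h2))"
      by (simp add: constant_degree)
    then obtain z where z: "poly (map_poly complex_of_real h2) z = 0"
      using fundamental_theorem_of_algebra by blast
    then have "poly (map_poly complex_of_real h) z = 0"
      by (simp only: h2 of_real_poly_hom.hom_mult poly_mult) simp
    then have "poly h2 b = 0" using root z by (metis of_real_eq_0_iff poly_of_real_map)
    then obtain h3 where "h2 = [:-b, 1:] * h3" by (auto simp: poly_eq_0_iff_dvd)
    then obtain q where "map_poly of_rat mb = [:-b, 1:] * ([:-b, 1:] * q)"
      using hb h2 by (metis dvdE mult.assoc)
    then have "poly (pderiv (map_poly of_rat mb)) b = 0" by (simp only: pderiv_double_root)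
    then have "rpoly (pderiv mb) b = 0" by (simp add: rpoly_def map_poly_of_rat_pderiv)
    then show False using minpoly_separable[OF mb minpoly_root[OF mb]] by simp
  qed
  then obtain k where k: "h2 = [:k:]" by (auto elim: degree_eq_zeroE)
  have "k \<noteq> 0" using h(2) h2 k by auto
  have "coeff h 0 \<in> rat_adjoin \<theta>" "coeff h 1 \<in> rat_adjoin \<theta>" using h(1) by (auto simp: polys_over_def)
  \<comment> \<open>Now h = k (X - b), so \<open>b\<close> is minus the quotient of the two
    coefficients.\<close>
  then have "- b * k \<in> rat_adjoin \<theta>" "k \<in> rat_adjoin \<theta>" by (auto simp: h2 k mult.commute)
  then have "- (- b * k / k) \<in> rat_adjoin \<theta>"
    by (intro subfield_minus[OF F] subfield_divide[OF F])
  then show ?thesis using that[of c] \<open>k \<noteq> 0\<close> by (simp add: \<theta>_def)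
qed

theorem primitive_element:
  assumes "finite S" "\<And>x. x \<in> S \<Longrightarrow> algebraic_int x"
  obtains \<theta> where "algebraic_int \<theta>" "gen_field S = rat_adjoin \<theta>"
proof -
  have "\<exists>\<theta>. algebraic_int \<theta> \<and> gen_field S = rat_adjoin \<theta>"
    using assms
  proof (induction S rule: finite_induct)
    case empty
    have "algebraic_int (0 :: real)" by simp
    then obtain m where "is_minpoly m (0 :: real)" by (rule algebraic_int_minpoly)
    then have "gen_field {} = rat_adjoin 0"
      by (intro equalityI gen_field_least rat_adjoin_least gen_field_subfield rat_adjoin_subfield
          subfield_0) auto
    then show ?case by (intro exI[of _ 0]) simp
  next
    case (insert b S)
    then obtain a where a: "algebraic_int a" "gen_field S = rat_adjoin a" by auto
    have b: "algebraic_int b" using insert.prems by simp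
    obtain c :: nat where c: "b \<in> rat_adjoin (a + of_nat c * b)" by (rule primitive_pair[OF a(1) b])
    define \<theta> where "\<theta> = a + of_nat c * b"
    have \<theta>: "algebraic_int \<theta>"
      unfolding \<theta>_def using a b by (auto intro: algebraic_int_add algebraic_int_mult)
    then obtain m where "is_minpoly m \<theta>" by (rule algebraic_int_minpoly)
    then have F: "is_subfield (rat_adjoin \<theta>)" by (rule rat_adjoin_subfield)
    have b': "b \<in> rat_adjoin \<theta>" using c by (simp add: \<theta>_def)
    have "a = \<theta> - of_nat c * b" by (simp add: \<theta>_def)
    then have "a \<in> rat_adjoin \<theta>"
      using b' by (metis F rat_adjoin_self subfield_diff subfield_mult subfield_of_nat)
    then have "rat_adjoin a \<subseteq> rat_adjoin \<theta>" by (intro rat_adjoin_least F)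
    moreover have "S \<subseteq> rat_adjoin a" using gen_field_superset a(2) by blast
    ultimately have sub: "gen_field (insert b S) \<subseteq> rat_adjoin \<theta>"
      using b' by (intro gen_field_least F) auto
    have G: "is_subfield (gen_field (insert b S))" by (rule gen_field_subfield)
    have "a \<in> gen_field S" using a(2) rat_adjoin_self by simp
    moreover have "gen_field S \<subseteq> gen_field (insert b S)"
      using gen_field_superset[of "insert b S"] by (intro gen_field_least G) auto
    moreover have "b \<in> gen_field (insert b S)" using gen_field_superset by blast
    ultimately have "\<theta> \<in> gen_field (insert b S)"
      unfolding \<theta>_def by (auto intro: subfield_add[OF G] subfield_mult[OF G] subfield_of_nat[OF G])
    then have "rat_adjoin \<theta> \<subseteq> gen_field (insert b S)" by (intro rat_adjoin_least G)
    then show ?case using sub \<theta> by blast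
  qed
  then show ?thesis using that by blast
qed

section \<open>Conjugates and norms\<close>

lemma prod_list_swap:
  fixes g :: "'a \<Rightarrow> 'b \<Rightarrow> 'c::comm_monoid_mult"
  shows "(\<Prod>a\<leftarrow>xs. \<Prod>b\<leftarrow>ys. g a b) = (\<Prod>b\<leftarrow>ys. \<Prod>a\<leftarrow>xs. g a b)"
proof (induction xs)
  case Nil
  have "(\<Prod>b\<leftarrow>ys. 1) = (1 :: 'c)" by (induction ys) auto
  then show ?case by simp
next
  case (Cons a xs)
  have "(\<Prod>b\<leftarrow>ys. g a b) * (\<Prod>b\<leftarrow>ys. h b) = (\<Prod>b\<leftarrow>ys. g a b * h b)" for h
    by (induction ys) (auto simp: ac_simps)
  then show ?case using Cons by simp
qed

lemma prod_list_scale: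
  fixes c :: "'a::comm_monoid_mult"
  shows "(\<Prod>a\<leftarrow>xs. c * g a) = c ^ length xs * (\<Prod>a\<leftarrow>xs. g a)"
  by (induction xs) (auto simp: ac_simps)

lemma poly_prod_linear: "poly (\<Prod>a\<leftarrow>as. [:- a, 1:]) x = (\<Prod>a\<leftarrow>as. x - a)"
  for x :: "'a::comm_ring_1"
  by (induction as) (auto simp: algebra_simps)

lemma monic_factorization:
  fixes p :: "complex poly"
  assumes "lead_coeff p = 1"
  obtains as where "p = (\<Prod>a\<leftarrow>as. [:- a, 1:])" "length as = degree p"
  using fundamental_theorem_algebra_factorized[of p] assms by (metis smult_1_left)

text \<open>The product is a resultant; exchanging the roles of the two polynomials and reducing one
  modulo the other is the Euclidean algorithm, so the product stays rational.\<close>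

lemma prod_conjugates_rational:
  fixes m f :: "rat poly" and as :: "complex list"
  assumes "lead_coeff m = 1" "map_poly of_rat m = (\<Prod>a\<leftarrow>as. [:- a, 1:])"
  shows "(\<Prod>a\<leftarrow>as. rpoly f a) \<in> \<rat>"
  using assms
proof (induction "degree m" arbitrary: m f as rule: less_induct)
  case less
  define r where "r = f mod m"
  have root: "rpoly m x = (\<Prod>a\<leftarrow>as. x - a)" for x :: complex
    using less.prems(2) by (simp add: rpoly_def poly_prod_linear)
  have "rpoly f a = rpoly r a" if "a \<in> set as" for a
  proof -
    have "rpoly m a = 0" using that by (auto simp: root prod_list_zero_iff)
    moreover have "rpoly f a = rpoly (f div m * m + r) a" by (simp only: r_def div_mult_mod_eq)
    ultimately show ?thesis by simp
  qed
  then have eq: "(\<Prod>a\<leftarrow>as. rpoly f a) = (\<Prod>a\<leftarrow>as. rpoly r a)"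
    by (metis (no_types, lifting) map_eq_conv)
  show ?case
  proof (cases "degree r = 0")
    case True
    then obtain k where "r = [:k:]" by (auto elim: degree_eq_zeroE)
    then have "(\<Prod>a\<leftarrow>as. rpoly r a) = of_rat k ^ length as"
      by (induction as) auto
    then show ?thesis using eq by (simp add: Rats_of_rat)
  next
    case False
    define l where "l = lead_coeff r"
    define r1 where "r1 = Polynomial.smult (inverse l) r"
    have r0: "r \<noteq> 0" "l \<noteq> 0" using False by (auto simp: l_def)
    have deg: "degree r1 < degree m"
      using r0 degree_mod_less'[of m f] less.prems(1) unfolding r1_def r_def by force
    have lc: "lead_coeff r1 = 1" using r0 by (simp add: r1_def l_def)
    have "lead_coeff (map_poly complex_of_rat r1) = 1" using lc by simp
    then obtain bs where bs: "map_poly complex_of_rat r1 = (\<Prod>b\<leftarrow>bs. [:- b, 1:])"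
      using monic_factorization by blast
    have r: "rpoly r x = of_rat l * (\<Prod>b\<leftarrow>bs. x - b)" for x :: complex
    proof -
      have "r = Polynomial.smult l r1" using r0 by (simp add: r1_def)
      then have "rpoly r x = of_rat l * rpoly r1 x" by simp
      then show ?thesis by (simp add: rpoly_def bs poly_prod_linear)
    qed
    have IH: "(\<Prod>b\<leftarrow>bs. rpoly m b) \<in> \<rat>" by (rule less.hyps[OF deg lc bs])
    have "(\<Prod>a\<leftarrow>as. rpoly r a) = of_rat l ^ length as * (\<Prod>a\<leftarrow>as. \<Prod>b\<leftarrow>bs. a - b)"
      by (simp add: r prod_list_scale)
    also have "(\<Prod>a\<leftarrow>as. \<Prod>b\<leftarrow>bs. a - b) = (\<Prod>b\<leftarrow>bs. \<Prod>a\<leftarrow>as. a - b)"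
      by (rule prod_list_swap)
    also have "\<dots> = (\<Prod>b\<leftarrow>bs. (- 1) ^ length as * rpoly m b)"
    proof -
      have "(\<Prod>a\<leftarrow>as. a - b) = (- 1) ^ length as * rpoly m b" for b
        using prod_list_scale[of "- 1" "\<lambda>a. b - a" as] by (simp add: root)
      then show ?thesis by simp
    qed
    also have "\<dots> = ((- 1) ^ length as) ^ length bs * (\<Prod>b\<leftarrow>bs. rpoly m b)"
      by (rule prod_list_scale)
    finally show ?thesis using IH eq by (simp add: Rats_of_rat)
  qed
qed

section \<open>The norm as a product over the complex conjugates of a generator\<close>

definition conjugates :: "rat poly \<Rightarrow> complex set" where
  "conjugates m = {z. rpoly m z = 0}"

context
  fixes m :: "rat poly" and \<theta> :: real
  assumes m: "is_minpoly m \<theta>"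
begin

text \<open>Separability excludes repeated roots, so a product over the set of conjugates is the
  same as a product over the list of linear factors.\<close>

lemma conjugates_list:
  obtains as where "conjugates m = set as" "distinct as" "length as = degree m"
    "map_poly of_rat m = (\<Prod>a\<leftarrow>as. [:- a, 1:])"
proof -
  have "lead_coeff (map_poly complex_of_rat m) = 1" using m by (simp add: is_minpoly_def)
  then obtain as where as: "map_poly complex_of_rat m = (\<Prod>a\<leftarrow>as. [:- a, 1:])"
    "length as = degree (map_poly complex_of_rat m)"
    by (rule monic_factorization)
  have len: "length as = degree m" using as(2) by simp
  have "conjugates m = set as"
    unfolding conjugates_def rpoly_def as(1) by (auto simp: poly_prod_linear prod_list_zero_iff)
  moreover have "distinct as"
  proof (rule ccontr)
    assume "\<not> distinct as"
    then obtain xs y ys zs where "as = xs @ [y] @ ys @ [y] @ zs" using not_distinct_decomp by blast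
    then have "map_poly of_rat m = [:- y, 1:] * ([:- y, 1:] * (\<Prod>a\<leftarrow>xs @ ys @ zs. [:- a, 1:]))"
      by (simp only: as(1) map_append prod_list.append list.map prod_list.Cons prod_list.Nil ac_simps mult_1)
    then have "poly (map_poly of_rat m) y = 0" "poly (pderiv (map_poly of_rat m)) y = 0"
      by (simp_all only: pderiv_double_root poly_mult) simp
    then show False using minpoly_separable[OF m, of y] by (simp add: rpoly_def map_poly_of_rat_pderiv)
  qed
  ultimately show ?thesis using that as(1) len by blast
qed

lemma finite_conjugates: "finite (conjugates m)"
  by (rule conjugates_list) simp

lemma card_conjugates: "card (conjugates m) = degree m"
  by (rule conjugates_list) (simp add: distinct_card)

lemma conjugates_prod_rational: "(\<Prod>z\<in>conjugates m. rpoly f z) \<in> \<rat>"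
proof -
  obtain as where as: "conjugates m = set as" "distinct as"
    "map_poly of_rat m = (\<Prod>a\<leftarrow>as. [:- a, 1:])" by (rule conjugates_list)
  have "lead_coeff m = 1" using m by (simp add: is_minpoly_def)
  then have "(\<Prod>a\<leftarrow>as. rpoly f a) \<in> \<rat>" by (rule prod_conjugates_rational[OF _ as(3)])
  then show ?thesis using as by (simp add: prod.distinct_set_conv_list)
qed

text \<open>The conjugates of an algebraic integer are roots of the same monic integer polynomial,
  so their product is an algebraic integer. Being rational as well, it is an ordinary integer, and
  it is nonzero because no conjugate of a nonzero element vanishes.\<close>

lemma norm_ge_1:
  assumes "algebraic_int (rpoly f \<theta>)" "rpoly f \<theta> \<noteq> 0"
  shows "1 \<le> (\<Prod>z\<in>conjugates m. cmod (rpoly f z))"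
proof -
  let ?P = "\<Prod>z\<in>conjugates m. rpoly f z"
  obtain p where p: "poly (map_poly of_int p) (rpoly f \<theta>) = 0" "lead_coeff p = 1"
    using assms(1) unfolding algebraic_int_altdef_ipoly by blast
  have "algebraic_int (rpoly f z)" if "z \<in> conjugates m" for z
  proof -
    have "rpoly (map_poly of_int p \<circ>\<^sub>p f) \<theta> = 0" using p(1) by (simp add: rpoly_of_int)
    moreover have "rpoly m z = 0" using that by (simp add: conjugates_def)
    ultimately have "rpoly (map_poly of_int p \<circ>\<^sub>p f) z = 0" using minpoly_conjugate[OF m] by blast
    then show ?thesis using p(2) unfolding algebraic_int_altdef_ipoly by (auto simp: rpoly_of_int)
  qed
  then have "algebraic_int ?P" by (rule algebraic_int_prod)
  then have "?P \<in> \<int>" using conjugates_prod_rational by (rule rational_algebraic_int_is_int)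
  then obtain n where n: "?P = of_int n" by (auto elim: Ints_cases)
  have "?P \<noteq> 0"
    using minpoly_conjugate[OF m] assms(2) finite_conjugates by (auto simp: conjugates_def)
  then have "n \<noteq> 0" using n by auto
  then have "1 \<le> cmod ?P" by (simp add: n)
  then show ?thesis by (simp add: prod_norm)
qed

end

section \<open>Field embeddings\<close>

context
  fixes F :: "real set" and \<phi> :: "real \<Rightarrow> 'b::comm_ring_1"
  assumes F: "is_subfield F" and \<phi>: "hom_on F \<phi>"
begin

lemma hom_on_1: "\<phi> 1 = 1"
  and hom_on_add: "x \<in> F \<Longrightarrow> y \<in> F \<Longrightarrow> \<phi> (x + y) = \<phi> x + \<phi> y"
  and hom_on_mult: "x \<in> F \<Longrightarrow> y \<in> F \<Longrightarrow> \<phi> (x * y) = \<phi> x * \<phi> y"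
  using \<phi> unfolding hom_on_def by auto

lemma hom_on_0: "\<phi> 0 = 0"
  using hom_on_add[OF subfield_0[OF F] subfield_0[OF F]] by simp

lemma hom_on_minus: "x \<in> F \<Longrightarrow> \<phi> (- x) = - \<phi> x"
  using hom_on_add[of x "- x"] subfield_minus[OF F] hom_on_0 by (simp add: eq_neg_iff_add_eq_0 add.commute)

lemma hom_on_diff: "x \<in> F \<Longrightarrow> y \<in> F \<Longrightarrow> \<phi> (x - y) = \<phi> x - \<phi> y"
  using hom_on_add[of x "- y"] hom_on_minus subfield_minus[OF F] by simp

lemma hom_on_power: "x \<in> F \<Longrightarrow> \<phi> (x ^ n) = \<phi> x ^ n"
  by (induction n) (auto simp: hom_on_1 hom_on_mult subfield_power[OF F])

lemma hom_on_of_nat: "\<phi> (of_nat n) = of_nat n"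
  by (induction n) (auto simp: hom_on_0 hom_on_1 hom_on_add subfield_1[OF F] subfield_of_nat[OF F])

lemma hom_on_numeral: "\<phi> (numeral n) = numeral n"
  using hom_on_of_nat[of "numeral n"] by simp

lemma hom_on_sum: "(\<And>i. i \<in> I \<Longrightarrow> f i \<in> F) \<Longrightarrow> \<phi> (sum f I) = (\<Sum>i\<in>I. \<phi> (f i))"
  by (induction I rule: infinite_finite_induct) (auto simp: hom_on_0 hom_on_add subfield_sum[OF F])

lemmas hom_on_simps = hom_on_0 hom_on_1 hom_on_add hom_on_mult hom_on_minus hom_on_diff
  hom_on_power hom_on_numeral

end

text \<open>This is the embedding sending \<theta> to \<open>z\<close>. The choice of the
  representing polynomial does not matter when \<open>z\<close> is a conjugate of \<theta>; outside
  Q(\<theta>) the value is arbitrary, which \<open>hom_on\<close> tolerates.\<close>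

definition conj_hom :: "real \<Rightarrow> complex \<Rightarrow> real \<Rightarrow> complex" where
  "conj_hom \<theta> z x = rpoly (SOME f. x = rpoly f \<theta>) z"

lemma conj_hom_rpoly:
  assumes m: "is_minpoly m \<theta>" and z: "z \<in> conjugates m"
  shows "conj_hom \<theta> z (rpoly f \<theta>) = rpoly f z"
proof -
  define g where "g = (SOME g. rpoly f \<theta> = rpoly g \<theta>)"
  have "rpoly f \<theta> = rpoly g \<theta>" unfolding g_def by (rule someI[of _ f]) simp
  then have "rpoly (f - g) \<theta> = 0" by simp
  moreover have "rpoly m z = 0" using z by (simp add: conjugates_def)
  ultimately have "rpoly (f - g) z = 0" using minpoly_conjugate[OF m] by blast
  then show ?thesis by (simp add: conj_hom_def g_def)
qed

lemma hom_on_conj_hom: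
  assumes m: "is_minpoly m \<theta>" and z: "z \<in> conjugates m"
  shows "hom_on (rat_adjoin \<theta>) (conj_hom \<theta> z)"
  unfolding hom_on_def
proof (intro conjI ballI)
  show "conj_hom \<theta> z 1 = 1" using conj_hom_rpoly[OF m z, of 1] by simp
next
  fix x y assume "x \<in> rat_adjoin \<theta>" "y \<in> rat_adjoin \<theta>"
  then obtain f g where [simp]: "x = rpoly f \<theta>" "y = rpoly g \<theta>" by (auto simp: rat_adjoin_def)
  show "conj_hom \<theta> z (x + y) = conj_hom \<theta> z x + conj_hom \<theta> z y"
    using conj_hom_rpoly[OF m z, of "f + g"] conj_hom_rpoly[OF m z] by simp
  show "conj_hom \<theta> z (x * y) = conj_hom \<theta> z x * conj_hom \<theta> z y"
    using conj_hom_rpoly[OF m z, of "f * g"] conj_hom_rpoly[OF m z] by simp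
qed

lemma hom_on_Re:
  assumes "hom_on F \<psi>" "\<And>x. x \<in> F \<Longrightarrow> Im (\<psi> x) = 0"
  shows "hom_on F (\<lambda>x. Re (\<psi> x))"
  using assms unfolding hom_on_def by auto

section \<open>Bounding the degree of a field by an integer with small conjugates\<close>

interpretation rat_vs: vector_space "\<lambda>(r::rat) (x::real). of_rat r * x"
  by unfold_locales (auto simp: of_rat_add of_rat_mult algebra_simps)

lemma qspan_eq_span: "finite B \<Longrightarrow> qspan B = rat_vs.span B"
  unfolding qspan_def rat_vs.span_finite by auto

text \<open>Stated for an indexed family, because injectivity of the indexing is itself a
  consequence of independence and would otherwise have to be shown for the products of basis
  elements with powers of \<theta>.\<close>

lemma card_le_if_independent_family:
  fixes v :: "'i \<Rightarrow> real"
  assumes fin: "finite I" "finite T" and sp: "v ` I \<subseteq> rat_vs.span T"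
    and ind: "\<And>c. (\<Sum>i\<in>I. of_rat (c i) * v i) = 0 \<Longrightarrow> \<forall>i\<in>I. c i = 0"
  shows "card I \<le> card T"
proof -
  have inj: "inj_on v I"
  proof (rule inj_onI, rule ccontr)
    fix i j assume ij: "i \<in> I" "j \<in> I" "v i = v j" "i \<noteq> j"
    define c :: "'i \<Rightarrow> rat" where "c k = (if k = i then 1 else 0) - (if k = j then 1 else 0)" for k
    have "(\<Sum>k\<in>I. of_rat (c k) * v k) = (\<Sum>k\<in>I. (if k = i then v k else 0) - (if k = j then v k else 0))"
      by (intro sum.cong) (auto simp: c_def)
    also have "\<dots> = v i - v j" using ij fin by (simp add: sum_subtractf)
    finally have "(\<Sum>k\<in>I. of_rat (c k) * v k) = 0" using ij by simp
    then have "c i = 0" using ind ij by blast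
    then show False using ij by (simp add: c_def)
  qed
  have "rat_vs.independent (v ` I)"
  proof
    assume "rat_vs.dependent (v ` I)"
    then obtain u where u: "\<exists>x\<in>v ` I. u x \<noteq> 0" "(\<Sum>x\<in>v ` I. of_rat (u x) * x) = 0"
      using rat_vs.dependent_finite fin by auto
    then have "(\<Sum>i\<in>I. of_rat (u (v i)) * v i) = 0" by (simp add: sum.reindex[OF inj])
    then show False using ind[of "\<lambda>i. u (v i)"] u(1) by auto
  qed
  then have "card (v ` I) \<le> card T" using rat_vs.independent_span_bound[OF fin(2) _ sp] by blast
  then show ?thesis by (simp add: card_image[OF inj])
qed

lemma rat_adjoin_span:
  assumes m: "is_minpoly m \<theta>"
  shows "rat_adjoin \<theta> \<subseteq> rat_vs.span ((\<lambda>i. \<theta> ^ i) ` {..<degree m})"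
proof
  fix x assume "x \<in> rat_adjoin \<theta>"
  then obtain f where x: "x = rpoly f \<theta>" by (auto simp: rat_adjoin_def)
  define r where "r = f mod m"
  have "rpoly f \<theta> = rpoly (f div m * m + r) \<theta>" by (simp only: r_def div_mult_mod_eq)
  then have "x = rpoly r \<theta>" using x minpoly_root[OF m] by simp
  also have "\<dots> = (\<Sum>i\<le>degree r. of_rat (coeff r i) * \<theta> ^ i)"
    by (simp add: rpoly_def poly_altdef)
  also have "\<dots> \<in> rat_vs.span ((\<lambda>i. \<theta> ^ i) ` {..<degree m})"
  proof (rule rat_vs.span_sum)
    fix i assume "i \<in> {..degree r}"
    moreover have "degree r < degree m"
      using degree_mod_less[of m f] minpoly_nonzero[OF m] minpoly_degree_pos[OF m] by (auto simp: r_def)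
    ultimately have "i < degree m" by simp
    then show "of_rat (coeff r i) * \<theta> ^ i \<in> rat_vs.span ((\<lambda>i. \<theta> ^ i) ` {..<degree m})"
      by (intro rat_vs.span_scale rat_vs.span_base) auto
  qed
  finally show "x \<in> rat_vs.span ((\<lambda>i. \<theta> ^ i) ` {..<degree m})" .
qed

text \<open>The powers of \<open>\<theta>\<close> below the number of embeddings that fix \<open>K\<close> are linearly independent over
  \<open>K\<close>, because such an embedding maps a polynomial relation for \<open>\<theta>\<close> with coefficients in \<open>K\<close> to the
  same relation for a conjugate of \<open>\<theta>\<close>.\<close>

lemma qdegree_mult_fixing_le:
  assumes m: "is_minpoly m \<theta>" and K: "is_subfield K" "K \<subseteq> rat_adjoin \<theta>"
    and E: "E \<subseteq> conjugates m" "\<And>z x. z \<in> E \<Longrightarrow> x \<in> K \<Longrightarrow> conj_hom \<theta> z x = of_real x"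
  shows "qfinite K \<and> qdegree K * card E \<le> degree m"
proof -
  let ?T = "(\<lambda>i. \<theta> ^ i) ` {..<degree m}"
  note L = rat_adjoin_subfield[OF m]
  have finT: "finite ?T" by simp
  have cardT: "card ?T \<le> degree m" using card_image_le[of "{..<degree m}"] by fastforce
  obtain B where B: "B \<subseteq> K" "rat_vs.independent B" "K \<subseteq> rat_vs.span B"
    by (rule rat_vs.maximal_independent_subset)
  have "B \<subseteq> rat_vs.span ?T" using B(1) K(2) rat_adjoin_span[OF m] by blast
  then have finB: "finite B" using rat_vs.independent_span_bound[OF finT B(2)] by blast
  have KB: "K \<subseteq> qspan B" using B(3) finB by (simp add: qspan_eq_span)
  have qf: "qfinite K" unfolding qfinite_def using finB B(1) KB by blast
  have qd: "qdegree K \<le> card B" unfolding qdegree_def using finB B(1) KB by (intro Least_le) blast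
  have finE: "finite E" using E(1) finite_conjugates[OF m] finite_subset by blast
  have "card (B \<times> {..<card E}) \<le> card ?T"
  proof (rule card_le_if_independent_family[where v = "\<lambda>(b, j). b * \<theta> ^ j"])
    show "finite (B \<times> {..<card E})" "finite ?T" using finB by auto
    have "b * \<theta> ^ j \<in> rat_adjoin \<theta>" if "b \<in> B" for b j
      using that B(1) K(2) by (intro subfield_mult[OF L] subfield_power[OF L] rat_adjoin_self) auto
    then show "(\<lambda>(b, j). b * \<theta> ^ j) ` (B \<times> {..<card E}) \<subseteq> rat_vs.span ?T"
      using rat_adjoin_span[OF m] by auto
  next
    fix c :: "real \<times> nat \<Rightarrow> rat"
    assume "(\<Sum>i\<in>B \<times> {..<card E}. of_rat (c i) * (case i of (b, j) \<Rightarrow> b * \<theta> ^ j)) = 0"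
    then have "(\<Sum>b\<in>B. \<Sum>j<card E. of_rat (c (b, j)) * (b * \<theta> ^ j)) = 0"
      by (simp add: sum.cartesian_product split_def)
    then have z0: "(\<Sum>j<card E. \<Sum>b\<in>B. of_rat (c (b, j)) * (b * \<theta> ^ j)) = 0"
      by (subst sum.swap)
    define k where "k j = (\<Sum>b\<in>B. of_rat (c (b, j)) * b)" for j
    have kK: "k j \<in> K" for j
      unfolding k_def using B(1) by (intro subfield_sum[OF K(1)] subfield_mult[OF K(1)] subfield_of_rat[OF K(1)]) auto
    then have kL: "k j \<in> rat_adjoin \<theta>" for j using K(2) by blast
    have rel: "(\<Sum>j<card E. k j * \<theta> ^ j) = 0"
      using z0 by (simp add: k_def sum_distrib_right mult.assoc)
    define g where "g = (\<Sum>j<card E. monom (complex_of_real (k j)) j)"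
    have cg: "coeff g i = (if i < card E then of_real (k i) else 0)" for i
      by (auto simp: g_def coeff_sum)
    have "g = 0"
    proof (rule ccontr)
      assume g0: "g \<noteq> 0"
      \<comment> \<open>\<open>g\<close> has only coefficients of index below \<open>card E\<close>,
        yet each of the \<open>card E\<close> conjugates in \<open>E\<close> is a root: the
        embedding fixes the coefficients, which lie in \<open>K\<close>, and moves \<theta> to
        \<open>z\<close>.\<close>
      have "E \<subseteq> {z. poly g z = 0}"
      proof
        fix z assume z: "z \<in> E"
        have zc: "z \<in> conjugates m" using z E(1) by blast
        note hom = hom_on_conj_hom[OF m zc]
        have th: "conj_hom \<theta> z \<theta> = z" using conj_hom_rpoly[OF m zc, of "[:0, 1:]"] by simp
        have "poly g z = (\<Sum>j<card E. conj_hom \<theta> z (k j) * conj_hom \<theta> z \<theta> ^ j)"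
          unfolding g_def using E(2)[OF z] kK by (simp add: poly_sum poly_monom th)
        also have "\<dots> = (\<Sum>j<card E. conj_hom \<theta> z (k j * \<theta> ^ j))"
          using kL rat_adjoin_self
          by (intro sum.cong) (auto simp: hom_on_mult[OF L hom] hom_on_power[OF L hom] subfield_power[OF L])
        also have "\<dots> = conj_hom \<theta> z (\<Sum>j<card E. k j * \<theta> ^ j)"
          using kL rat_adjoin_self
          by (subst hom_on_sum[OF L hom]) (auto intro: subfield_mult[OF L] subfield_power[OF L])
        finally show "z \<in> {z. poly g z = 0}" by (simp add: rel hom_on_0[OF L hom])
      qed
      then have "card E \<le> card {z. poly g z = 0}"
        using poly_roots_finite[OF g0] by (rule card_mono[rotated])
      also have "\<dots> \<le> degree g" using g0 by (rule card_poly_roots_bound)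
      finally have "coeff g (degree g) = 0" by (simp add: cg)
      then show False using g0 by simp
    qed
    then have "k j = 0" if "j < card E" for j using cg[of j] that by simp
    then have "c (b, j) = 0" if "j < card E" "b \<in> B" for b j
      using B(2) rat_vs.dependent_finite[OF finB] that unfolding k_def by metis
    then show "\<forall>i\<in>B \<times> {..<card E}. c i = 0" by auto
  qed
  then have "card B * card E \<le> degree m" using cardT by (simp add: card_cartesian_product)
  moreover have "qdegree K * card E \<le> card B * card E" using qd by (rule mult_right_mono) simp
  ultimately show ?thesis using qf by linarith
qed

text \<open>Let e be the number of embeddings of the large field that fix \<open>K\<close> pointwise
  and d its degree. The norm of \<open>W\<close> from the large field gives 1 \<le> \<bar>W\<bar>^e
  c^(d - e), while [K:Q] e \<le> d. Both sides scale with e, so the conclusion concerns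
  \<open>K\<close> alone.\<close>

theorem qdegree_le_if_small_conjugates:
  assumes S: "finite S" "\<And>x. x \<in> S \<Longrightarrow> algebraic_int x"
    and real: "totally_real (gen_field S)"
    and K: "is_subfield K" "K \<subseteq> gen_field S"
    and W: "W \<in> K" "algebraic_int W" "W \<noteq> 0"
    and small: "\<And>\<phi> :: real \<Rightarrow> real. hom_on (gen_field S) \<phi> \<Longrightarrow> \<exists>x\<in>K. \<phi> x \<noteq> x \<Longrightarrow> \<bar>\<phi> W\<bar> \<le> c"
    and c: "0 \<le> c" "c \<le> 1" "\<bar>W\<bar> * c ^ n < 1"
  shows "qfinite K \<and> qdegree K \<le> n"
proof -
  obtain \<theta> where \<theta>: "algebraic_int \<theta>" "gen_field S = rat_adjoin \<theta>"
    by (rule primitive_element[OF S])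
  obtain m where m: "is_minpoly m \<theta>" by (rule algebraic_int_minpoly[OF \<theta>(1)])
  have im: "Im (conj_hom \<theta> z x) = 0" if "z \<in> conjugates m" "x \<in> rat_adjoin \<theta>" for z x
    using real hom_on_conj_hom[OF m that(1)] that(2) unfolding \<theta>(2) totally_real_def by blast
  define E where "E = {z \<in> conjugates m. \<forall>x\<in>K. conj_hom \<theta> z x = of_real x}"
  have E: "E \<subseteq> conjugates m" by (auto simp: E_def)
  have finE: "finite E" using E finite_conjugates[OF m] finite_subset by blast
  have deg: "qfinite K \<and> qdegree K * card E \<le> degree m"
    using K \<theta>(2) by (intro qdegree_mult_fixing_le[OF m]) (auto simp: E_def)
  have \<theta>E: "of_real \<theta> \<in> E"
  proof -
    have z: "of_real \<theta> \<in> conjugates m"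
      using minpoly_root[OF m] by (simp add: conjugates_def of_real_rpoly[symmetric])
    have "conj_hom \<theta> (of_real \<theta>) x = of_real x" if x: "x \<in> K" for x
    proof -
      obtain f where "x = rpoly f \<theta>" using x K(2) \<theta>(2) by (auto simp: rat_adjoin_def)
      then show ?thesis using conj_hom_rpoly[OF m z, of f] by (simp add: of_real_rpoly)
    qed
    then show ?thesis using z by (simp add: E_def)
  qed
  then have e_pos: "card E > 0" using finE by (auto simp: card_gt_0_iff)
  obtain f where f: "W = rpoly f \<theta>" using W(1) K(2) \<theta>(2) by (auto simp: rat_adjoin_def)
  have WE: "cmod (rpoly f z) = \<bar>W\<bar>" if "z \<in> E" for z
  proof -
    have "conj_hom \<theta> z W = of_real W" using that W(1) by (simp add: E_def)
    moreover have "conj_hom \<theta> z W = rpoly f z" using conj_hom_rpoly[OF m, of z f] that E f by auto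
    ultimately show ?thesis by (metis norm_of_real)
  qed
  have WnE: "cmod (rpoly f z) \<le> c" if z: "z \<in> conjugates m - E" for z
  proof -
    have zc: "z \<in> conjugates m" using z by simp
    \<comment> \<open>Total reality makes the complex embedding real-valued on the field, so taking
      the real part loses nothing and gives the kind of embedding that \<open>small\<close> speaks
      about.\<close>
    define \<phi> where "\<phi> x = Re (conj_hom \<theta> z x)" for x
    have "hom_on (gen_field S) \<phi>"
      unfolding \<phi>_def \<theta>(2) by (intro hom_on_Re hom_on_conj_hom[OF m zc] im[OF zc])
    moreover have eq: "conj_hom \<theta> z x = of_real (\<phi> x)" if "x \<in> rat_adjoin \<theta>" for x
      using im[OF zc that] by (simp add: \<phi>_def complex_eq_iff)
    have "\<exists>x\<in>K. \<phi> x \<noteq> x"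
    proof (rule ccontr)
      assume "\<not> (\<exists>x\<in>K. \<phi> x \<noteq> x)"
      then have "z \<in> E" using eq K(2) zc \<theta>(2) by (auto simp: E_def)
      then show False using z by simp
    qed
    ultimately have "\<bar>\<phi> W\<bar> \<le> c" by (rule small)
    moreover have "rpoly f z = of_real (\<phi> W)"
      using eq[of W] W(1) K(2) \<theta>(2) conj_hom_rpoly[OF m zc, of f] f by auto
    ultimately show ?thesis by simp
  qed
  have "1 \<le> (\<Prod>z\<in>conjugates m. cmod (rpoly f z))"
    using W by (intro norm_ge_1[OF m]) (auto simp: f)
  also have "\<dots> = (\<Prod>z\<in>conjugates m - E. cmod (rpoly f z)) * (\<Prod>z\<in>E. cmod (rpoly f z))"
    by (rule prod.subset_diff[OF E finite_conjugates[OF m]])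
  also have "\<dots> \<le> c ^ (degree m - card E) * \<bar>W\<bar> ^ card E"
  proof (rule mult_mono)
    have "(\<Prod>z\<in>conjugates m - E. cmod (rpoly f z)) \<le> (\<Prod>z\<in>conjugates m - E. c)"
      using WnE by (intro prod_mono) auto
    then show "(\<Prod>z\<in>conjugates m - E. cmod (rpoly f z)) \<le> c ^ (degree m - card E)"
      by (simp add: card_Diff_subset[OF finE E] card_conjugates[OF m])
    show "(\<Prod>z\<in>E. cmod (rpoly f z)) \<le> \<bar>W\<bar> ^ card E" using WE by simp
  qed (use c in \<open>auto intro: prod_nonneg\<close>)
  finally have ge: "1 \<le> c ^ (degree m - card E) * \<bar>W\<bar> ^ card E" .
  \<comment> \<open>Otherwise at least \<open>n * card E\<close> conjugates lie outside
    \<open>E\<close>, and the norm is at most the \<open>card E\<close>-th power of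
    \<open>\<bar>W\<bar> * c ^ n\<close>, hence below 1. Positivity of \<open>card E\<close>,
    supplied by the identity embedding, is used here.\<close>
  have "degree m < Suc n * card E"
  proof (rule ccontr)
    assume "\<not> degree m < Suc n * card E"
    then have "n * card E \<le> degree m - card E" by simp
    then have "c ^ (degree m - card E) \<le> c ^ (n * card E)" using c by (intro power_decreasing)
    then have "1 \<le> c ^ (n * card E) * \<bar>W\<bar> ^ card E"
      using ge by (meson mult_right_mono order_trans zero_le_power abs_ge_zero)
    also have "\<dots> = (\<bar>W\<bar> * c ^ n) ^ card E" by (simp add: power_mult power_mult_distrib)
    also have "\<dots> < 1" using c e_pos by (intro power_less_one_iff[THEN iffD2]) auto
    finally show False by simp
  qed
  then have "qdegree K * card E < Suc n * card E" using deg by linarith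
  then have "qdegree K < Suc n" by (metis mult_less_cancel2)
  then have "qdegree K \<le> n" by simp
  then show ?thesis using deg by blast
qed

section \<open>The Gram matrix\<close>

lemma cyclic_product_2:
  assumes "i < dim_row A" "j < dim_row A"
  shows "A $$ (i, j) * A $$ (j, i) \<in> cyclic_products A"
  unfolding cyclic_products_def using assms
  by (intro CollectI exI[of _ 2] exI[of _ "\<lambda>l. if l = 0 then i else j"])
    (auto simp: lessThan_nat_numeral)

lemma cyclic_product_3:
  assumes "i < dim_row A" "j < dim_row A" "l < dim_row A"
  shows "A $$ (i, j) * A $$ (j, l) * A $$ (l, i) \<in> cyclic_products A"
  unfolding cyclic_products_def using assms
  by (intro CollectI exI[of _ 3] exI[of _ "\<lambda>n. if n = 0 then i else if n = 1 then j else l"])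
    (auto simp: lessThan_nat_numeral)

lemma cyclic_products_subset:
  assumes "A \<in> carrier_mat n n"
  shows "cyclic_products A \<subseteq> gen_field (entries A)"
proof
  fix x assume "x \<in> cyclic_products A"
  then obtain k idx where x: "x = (\<Prod>j<k. A $$ (idx j, idx (Suc j mod k)))" "k \<ge> 1"
    and idx: "\<forall>j<k. idx j < dim_row A" unfolding cyclic_products_def by blast
  have "A $$ (idx j, idx (Suc j mod k)) \<in> gen_field (entries A)" if "j < k" for j
  proof -
    have "Suc j mod k < k" using x(2) by simp
    then have "A $$ (idx j, idx (Suc j mod k)) \<in> entries A"
      unfolding entries_def using idx that assms
      by (intro CollectI exI[of _ "idx j"] exI[of _ "idx (Suc j mod k)"]) auto
    then show ?thesis using gen_field_superset by blast
  qed
  then show "x \<in> gen_field (entries A)"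
    unfolding x(1) by (intro subfield_prod[OF gen_field_subfield]) auto
qed

text \<open>By symmetry the square of an entry is a cyclic product of length two, and a square root
  of an algebraic integer is again one.\<close>

lemma V_arithmetic_entries_algebraic_int:
  assumes "V_arithmetic A" "x \<in> entries A"
  shows "algebraic_int x"
proof -
  obtain n where n: "A \<in> carrier_mat n n" "\<forall>i<n. \<forall>j<n. A $$ (i, j) = A $$ (j, i)"
    using assms(1) unfolding V_arithmetic_def fundamental_def by blast
  obtain i j where ij: "i < n" "j < n" "x = A $$ (i, j)"
    using assms(2) n(1) unfolding entries_def by auto
  have "A $$ (i, j) * A $$ (j, i) \<in> cyclic_products A" using ij n(1) by (intro cyclic_product_2) auto
  then have "x\<^sup>2 \<in> cyclic_products A" using ij n(2) by (simp add: power2_eq_square)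
  then have "algebraic_int (x\<^sup>2)" using assms(1) unfolding V_arithmetic_def alg_int_iff by blast
  then have "algebraic_int (sqrt (x\<^sup>2))" by (rule algebraic_int_sqrt)
  then show ?thesis by simp
qed

text \<open>The vector is chosen so that its last two coordinates maximise the form for given first two;
  this is the Schur complement.\<close>

lemma neg_definite_schur:
  fixes B :: "real mat"
  assumes B: "B \<in> carrier_mat 4 4" and neg: "neg_definite B"
    and diag: "B $$ (0,0) = -2" "B $$ (1,1) = -2" "B $$ (2,2) = -2" "B $$ (3,3) = -2"
    and off: "B $$ (0,1) = u" "B $$ (1,0) = u" "B $$ (0,2) = a" "B $$ (2,0) = a"
      "B $$ (1,2) = b" "B $$ (2,1) = b" "B $$ (0,3) = c" "B $$ (3,0) = c"
      "B $$ (1,3) = 0" "B $$ (3,1) = 0" "B $$ (2,3) = 0" "B $$ (3,2) = 0"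
  shows "a\<^sup>2 + c\<^sup>2 < 4" "b\<^sup>2 < 4" "(2 * u + a * b)\<^sup>2 < (4 - a\<^sup>2 - c\<^sup>2) * (4 - b\<^sup>2)"
proof -
  have form: "(4 - a\<^sup>2 - c\<^sup>2) * x\<^sup>2 + (4 - b\<^sup>2) * y\<^sup>2 - 2 * (2 * u + a * b) * x * y > 0"
    if xy: "x \<noteq> 0 \<or> y \<noteq> 0" for x y
  proof -
    define f where "f = (\<lambda>i::nat. if i = 0 then x else if i = 1 then y
      else if i = 2 then (a * x + b * y) / 2 else c * x / 2)"
    define v where "v = vec 4 f"
    have f: "f 0 = x" "f 1 = y" "f 2 = (a * x + b * y) / 2" "f 3 = c * x / 2" "f (Suc 0) = y" by (auto simp: f_def)
    have four: "{0..<4::nat} = {0, 1, 2, 3}" by auto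
    have "v \<noteq> 0\<^sub>v 4"
    proof
      assume "v = 0\<^sub>v 4"
      then have "v $ 0 = 0" "v $ 1 = 0" by simp_all
      then show False using xy f by (simp add: v_def)
    qed
    then have "v \<bullet> (B *\<^sub>v v) < 0"
      using neg B unfolding neg_definite_def by (auto simp: v_def)
    moreover have "v \<bullet> (B *\<^sub>v v) = (\<Sum>i\<in>{0..<4}. f i * (\<Sum>j\<in>{0..<4}. B $$ (i, j) * f j))"
      using B by (auto simp: v_def scalar_prod_def intro!: sum.cong)
    moreover have "\<dots> = - ((4 - a\<^sup>2 - c\<^sup>2) * x\<^sup>2 + (4 - b\<^sup>2) * y\<^sup>2 - 2 * (2 * u + a * b) * x * y) / 2"
      unfolding four using diag off
      by (simp add: f) (simp add: field_simps power2_eq_square)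
    ultimately show ?thesis by simp
  qed
  show "a\<^sup>2 + c\<^sup>2 < 4" using form[of 1 0] by simp
  show b: "b\<^sup>2 < 4" using form[of 0 1] by simp
  \<comment> \<open>For x equal to the coefficient of \<open>y\<^sup>2\<close> and y equal to half
    the negated mixed coefficient, the binary form becomes that coefficient times its
    discriminant-like determinant.\<close>
  have "(4 - b\<^sup>2) * ((4 - a\<^sup>2 - c\<^sup>2) * (4 - b\<^sup>2) - (2 * u + a * b)\<^sup>2) > 0"
    using form[of "4 - b\<^sup>2" "2 * u + a * b"] b by (simp add: power2_eq_square algebra_simps)
  then show "(2 * u + a * b)\<^sup>2 < (4 - a\<^sup>2 - c\<^sup>2) * (4 - b\<^sup>2)"
    using b by (simp add: zero_less_mult_iff)
qed

text \<open>An inductive description of Z[t, p, d] as functions, so that membership in a subfield,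
  integrality and compatibility with embeddings each follow by one induction over how
  \<open>W\<close> is built.\<close>

inductive int_polynomial :: "(real \<Rightarrow> real \<Rightarrow> real \<Rightarrow> real) \<Rightarrow> bool" where
  proj1: "int_polynomial (\<lambda>t p d. t)"
| proj2: "int_polynomial (\<lambda>t p d. p)"
| proj3: "int_polynomial (\<lambda>t p d. d)"
| one: "int_polynomial (\<lambda>t p d. 1)"
| add: "int_polynomial f \<Longrightarrow> int_polynomial g \<Longrightarrow> int_polynomial (\<lambda>t p d. f t p d + g t p d)"
| diff: "int_polynomial f \<Longrightarrow> int_polynomial g \<Longrightarrow> int_polynomial (\<lambda>t p d. f t p d - g t p d)"
| mult: "int_polynomial f \<Longrightarrow> int_polynomial g \<Longrightarrow> int_polynomial (\<lambda>t p d. f t p d * g t p d)"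

lemma int_polynomial_power:
  "int_polynomial f \<Longrightarrow> int_polynomial (\<lambda>t p d. f t p d ^ n)"
  by (induction n) (auto intro: int_polynomial.intros)

lemma int_polynomial_of_nat: "int_polynomial (\<lambda>t p d. of_nat n)"
proof (induction n)
  case 0
  show ?case using int_polynomial.diff[OF int_polynomial.one int_polynomial.one] by simp
next
  case (Suc n)
  then show ?case using int_polynomial.add[OF int_polynomial.one Suc] by simp
qed

lemma int_polynomial_numeral: "int_polynomial (\<lambda>t p d. numeral n)"
  using int_polynomial_of_nat[of "numeral n"] by simp

lemmas int_polynomial_intros = int_polynomial.intros int_polynomial_power int_polynomial_numeral

lemma int_polynomial_subfield:
  assumes "int_polynomial f" "is_subfield F" "t \<in> F" "p \<in> F" "d \<in> F"
  shows "f t p d \<in> F"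
  using assms by (induction rule: int_polynomial.induct)
    (auto intro: subfield_1 subfield_add subfield_diff subfield_mult)

lemma int_polynomial_algebraic_int:
  assumes "int_polynomial f" "algebraic_int t" "algebraic_int p" "algebraic_int d"
  shows "algebraic_int (f t p d)"
  using assms by (induction rule: int_polynomial.induct)
    (auto intro: algebraic_int_add algebraic_int_diff algebraic_int_mult)

lemma int_polynomial_hom_on:
  assumes "int_polynomial f" "is_subfield F" "hom_on F \<phi>" "t \<in> F" "p \<in> F" "d \<in> F"
  shows "\<phi> (f t p d) = f (\<phi> t) (\<phi> p) (\<phi> d)"
  using assms
proof (induction rule: int_polynomial.induct)
  case (add f g)
  then show ?case using hom_on_add int_polynomial_subfield by metis
next
  case (diff f g)
  then show ?case using hom_on_diff int_polynomial_subfield by metis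
next
  case (mult f g)
  then show ?case using hom_on_mult int_polynomial_subfield by metis
qed (auto simp: hom_on_1)

text \<open>The functions \<open>W\<close> below are applied to \<open>u\<^sup>2 + u a b\<close>, \<open>b\<^sup>2\<close> and \<open>4 - a\<^sup>2 - c\<^sup>2\<close>, which are
  integral elements of the ground field.\<close>

lemma ground_field_degree_bound:
  fixes u a b c :: real and W :: "real \<Rightarrow> real \<Rightarrow> real \<Rightarrow> real"
  assumes A_def: "A = mat 4 4 (\<lambda>(i,j).
        if i = j then -2
        else if {i,j} = {0,1} then u
        else if {i,j} = {0,2} then a
        else if {i,j} = {1,2} then b
        else if {i,j} = {0,3} then c
        else 0)"
    and V: "V_arithmetic A"
    and W: "int_polynomial W" "W (u\<^sup>2 + u * a * b) (b\<^sup>2) (4 - a\<^sup>2 - c\<^sup>2) \<noteq> 0"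
    and R: "\<And>F (\<phi> :: real \<Rightarrow> real). is_subfield F \<Longrightarrow> hom_on F \<phi> \<Longrightarrow> a \<in> F \<Longrightarrow> b \<in> F \<Longrightarrow> c \<in> F \<Longrightarrow>
      R (\<phi> a) (\<phi> b) (\<phi> c)"
    and small: "\<And>u a b c. R a b c \<Longrightarrow> a\<^sup>2 + c\<^sup>2 < 4 \<Longrightarrow> b\<^sup>2 < 4 \<Longrightarrow>
      (2 * u + a * b)\<^sup>2 < (4 - a\<^sup>2 - c\<^sup>2) * (4 - b\<^sup>2) \<Longrightarrow>
      \<bar>W (u\<^sup>2 + u * a * b) (b\<^sup>2) (4 - a\<^sup>2 - c\<^sup>2)\<bar> \<le> \<kappa>"
    and \<kappa>: "0 \<le> \<kappa>" "\<kappa> \<le> 1"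
    and n: "\<bar>W (u\<^sup>2 + u * a * b) (b\<^sup>2) (4 - a\<^sup>2 - c\<^sup>2)\<bar> * \<kappa> ^ n < 1"
  shows "qfinite (ground_field A) \<and> qdegree (ground_field A) \<le> n"
proof -
  let ?L = "gen_field (entries A)" and ?K = "ground_field A"
  let ?t = "u\<^sup>2 + u * a * b" and ?p = "b\<^sup>2" and ?d = "4 - a\<^sup>2 - c\<^sup>2"
  have car: "A \<in> carrier_mat 4 4" by (simp add: A_def)
  have ent: "A $$ (0,0) = -2" "A $$ (1,1) = -2" "A $$ (2,2) = -2" "A $$ (3,3) = -2"
    "A $$ (0,1) = u" "A $$ (1,0) = u" "A $$ (0,2) = a" "A $$ (2,0) = a"
    "A $$ (1,2) = b" "A $$ (2,1) = b" "A $$ (0,3) = c" "A $$ (3,0) = c"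
    "A $$ (1,3) = 0" "A $$ (3,1) = 0" "A $$ (2,3) = 0" "A $$ (3,2) = 0"
    by (simp_all add: A_def doubleton_eq_iff)
  note L = gen_field_subfield[of "entries A"]
  have K: "is_subfield ?K" unfolding ground_field_def by (rule gen_field_subfield)
  have KL: "?K \<subseteq> ?L"
    unfolding ground_field_def by (intro gen_field_least L cyclic_products_subset[OF car])
  have cyc: "u * u \<in> cyclic_products A" "a * a \<in> cyclic_products A" "b * b \<in> cyclic_products A"
    "c * c \<in> cyclic_products A" "u * b * a \<in> cyclic_products A"
    using cyclic_product_2[of 0 A 1] cyclic_product_2[of 0 A 2] cyclic_product_2[of 1 A 2]
      cyclic_product_2[of 0 A 3] cyclic_product_3[of 0 A 1 2] car ent by auto
  have cK: "cyclic_products A \<subseteq> ?K" unfolding ground_field_def by (rule gen_field_superset)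
  have mem: "?t \<in> ?K" "?p \<in> ?K" "?d \<in> ?K"
  proof -
    have [simp]: "u * u \<in> ?K" "a * a \<in> ?K" "b * b \<in> ?K" "c * c \<in> ?K" "u * b * a \<in> ?K"
      using cyc cK by auto
    \<comment> \<open>\<open>u\<close> itself need not lie in the ground field. The sum combines a
      cyclic product of length two with the one around the triangle of the first three
      indices.\<close>
    have "?t = u * u + u * b * a" by (simp add: power2_eq_square mult_ac)
    moreover have "u * u + u * b * a \<in> ?K" by (intro subfield_add[OF K]) simp_all
    ultimately show "?t \<in> ?K" by (simp only:)
    show "?p \<in> ?K" by (simp add: power2_eq_square)
    show "?d \<in> ?K"
      by (auto simp: power2_eq_square intro!: subfield_diff[OF K] subfield_numeral[OF K])
  qed
  have "u \<in> entries A" "a \<in> entries A" "b \<in> entries A" "c \<in> entries A"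
    unfolding entries_def using car ent by force+
  then have uL: "u \<in> ?L" "a \<in> ?L" "b \<in> ?L" "c \<in> ?L"
    and int: "algebraic_int u" "algebraic_int a" "algebraic_int b" "algebraic_int c"
    using gen_field_superset V_arithmetic_entries_algebraic_int[OF V] by blast+
  note L_intros = subfield_add[OF L] subfield_mult[OF L] subfield_power[OF L] subfield_diff[OF L]
    subfield_numeral[OF L]
  show ?thesis
  proof (rule qdegree_le_if_small_conjugates[OF _ _ _ K KL _ _ W(2) _ \<kappa> n])
    have "entries A = (\<lambda>(i, j). A $$ (i, j)) ` ({..<dim_row A} \<times> {..<dim_col A})"
      unfolding entries_def by auto
    then show "finite (entries A)" by simp
    show "totally_real ?L" using V by (simp add: V_arithmetic_def)
    show "W ?t ?p ?d \<in> ?K" by (rule int_polynomial_subfield[OF W(1) K mem])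
    show "algebraic_int (W ?t ?p ?d)"
      by (intro int_polynomial_algebraic_int[OF W(1)] algebraic_int_add algebraic_int_diff
          algebraic_int_mult algebraic_int_power algebraic_int_numeral int)
  next
    fix \<phi> :: "real \<Rightarrow> real"
    assume hom: "hom_on ?L \<phi>" and "\<exists>x\<in>?K. \<phi> x \<noteq> x"
    then have neg: "neg_definite (map_mat \<phi> A)" using V by (simp add: V_arithmetic_def)
    note hs = hom_on_add[OF L hom] hom_on_mult[OF L hom] hom_on_power[OF L hom]
      hom_on_diff[OF L hom] hom_on_numeral[OF L hom]
    have \<phi>0: "\<phi> 0 = 0" by (rule hom_on_0[OF L hom])
    have \<phi>2: "\<phi> (-2) = -2"
      using hom_on_minus[OF L hom subfield_numeral[OF L]] hom_on_numeral[OF L hom] by metis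
    have car': "map_mat \<phi> A \<in> carrier_mat 4 4" using car by simp
    have ix: "map_mat \<phi> A $$ (i, j) = \<phi> (A $$ (i, j))" if "i < 4" "j < 4" for i j
      using that car by simp
    have ineqs: "(\<phi> a)\<^sup>2 + (\<phi> c)\<^sup>2 < 4" "(\<phi> b)\<^sup>2 < 4"
      "(2 * \<phi> u + \<phi> a * \<phi> b)\<^sup>2 < (4 - (\<phi> a)\<^sup>2 - (\<phi> c)\<^sup>2) * (4 - (\<phi> b)\<^sup>2)"
      by (rule neg_definite_schur[OF car' neg]; simp add: ix ent \<phi>0 \<phi>2 del: One_nat_def)+
    have "\<phi> (W ?t ?p ?d) = W (\<phi> ?t) (\<phi> ?p) (\<phi> ?d)"
      using mem KL by (intro int_polynomial_hom_on[OF W(1) L hom]) auto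
    also have "\<phi> ?t = (\<phi> u)\<^sup>2 + \<phi> u * \<phi> a * \<phi> b" using uL by (simp add: hs L_intros)
    also have "\<phi> ?p = (\<phi> b)\<^sup>2" using uL by (simp add: hs)
    also have "\<phi> ?d = 4 - (\<phi> a)\<^sup>2 - (\<phi> c)\<^sup>2" using uL by (simp add: hs L_intros)
    finally have eq: "\<phi> (W ?t ?p ?d) =
      W ((\<phi> u)\<^sup>2 + \<phi> u * \<phi> a * \<phi> b) ((\<phi> b)\<^sup>2) (4 - (\<phi> a)\<^sup>2 - (\<phi> c)\<^sup>2)" .
    \<comment> \<open>\<open>R\<close> carries the algebraic relations among \<open>a\<close>,
      \<open>b\<close>, \<open>c\<close> that every embedding preserves; about the image of
      \<open>u\<close> only the inequalities from negative definiteness are known.\<close>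
    show "\<bar>\<phi> (W ?t ?p ?d)\<bar> \<le> \<kappa>"
      unfolding eq by (rule small[OF R[OF L hom uL(2-4)] ineqs])
  qed (rule V_arithmetic_entries_algebraic_int[OF V])
qed

section \<open>Bounds away from the identity\<close>

lemma mult_one_minus_le_quarter: "y * (1 - y) \<le> 1 / 4" for y :: real
  using zero_le_power2[of "y - 1 / 2"] by (simp add: power2_eq_square algebra_simps)

lemma square_sum_bounds:
  fixes u a b d :: real
  assumes "(2 * u + a * b)\<^sup>2 < d * (4 - b\<^sup>2)"
  defines "t \<equiv> u\<^sup>2 + u * a * b"
  shows "0 \<le> 4 * t + a\<^sup>2 * b\<^sup>2" "4 * t + a\<^sup>2 * b\<^sup>2 < d * (4 - b\<^sup>2)"
proof -
  have "4 * t + a\<^sup>2 * b\<^sup>2 = (2 * u + a * b)\<^sup>2"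
    unfolding t_def by (simp add: power2_eq_square algebra_simps)
  then show "0 \<le> 4 * t + a\<^sup>2 * b\<^sup>2" "4 * t + a\<^sup>2 * b\<^sup>2 < d * (4 - b\<^sup>2)" using assms by auto
qed

text \<open>On [-1, 1/3] the cubic T^2 (T + 1) is nonnegative and reaches its maximum 4/27 twice, at
  the critical point -2/3 and at the end 1/3. The squared factor is chosen for this equal
  height.\<close>

lemma bound_33:
  fixes t p :: real
  assumes p: "0 \<le> p" "p \<le> 4" and t: "0 \<le> 4 * t + p" "4 * t + p \<le> 2 * (4 - p)"
  shows "\<bar>(t * (t + p - 2))\<^sup>2 * (t * (t + p - 2) + 1)\<bar> \<le> 4 / 27"
proof -
  define T where "T = t * (t + p - 2)"
  have lo: "T \<ge> -1"
  proof (cases "t \<ge> 0")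
    case True
    have "T + 1 = (t - 1)\<^sup>2 + t * p" by (simp add: T_def power2_eq_square algebra_simps)
    also have "\<dots> \<ge> 0" using True p by simp
    finally show ?thesis by simp
  next
    \<comment> \<open>Negative t is balanced by p \<le> 4, just as nonnegative t is by p \<ge> 0 in
      the other case.\<close>
    case False
    have "T + 1 = (t + 1)\<^sup>2 + (- t) * (4 - p)" by (simp add: T_def power2_eq_square algebra_simps)
    moreover have "(- t) * (4 - p) \<ge> 0" using False p by (intro mult_nonneg_nonneg) auto
    ultimately show ?thesis using zero_le_power2[of "t + 1"] by linarith
  qed
  \<comment> \<open>The product of the two edge forms is 8 p - 3 p^2 - 16 T. Completing the square
    in p yields the upper bound for T, attained at p = 4/3.\<close>
  have "(4 * t + p) * (8 - 3 * p - 4 * t) \<ge> 0" using t by (intro mult_nonneg_nonneg) auto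
  moreover have "3 * ((4 * t + p) * (8 - 3 * p - 4 * t)) = 16 - 48 * T - (3 * p - 4)\<^sup>2"
    by (simp add: T_def power2_eq_square algebra_simps)
  ultimately have hi: "T \<le> 1 / 3" using zero_le_power2[of "3 * p - 4"] by linarith
  have "4 - 27 * (T\<^sup>2 * (T + 1)) = (1 - 3 * T) * (3 * T + 2)\<^sup>2"
    by (simp add: power2_eq_square algebra_simps)
  also have "\<dots> \<ge> 0" using hi by simp
  finally have "T\<^sup>2 * (T + 1) \<le> 4 / 27" by simp
  moreover have "T\<^sup>2 * (T + 1) \<ge> 0" using lo by simp
  ultimately show ?thesis by (simp add: T_def)
qed

text \<open>With s = t + p - 1 the polynomial is s^2 (s - 1) t. The inequality \<bar>t\<bar> \<le> 1
  + s, from p \<ge> 0 and from the lower edge, reduces it to y (1 - y) with y = s^2.\<close>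

lemma bound_43:
  fixes t p :: real
  assumes p: "0 \<le> p" "p \<le> 4" and t: "0 \<le> 4 * t + 2 * p" "4 * t + 2 * p \<le> 4 - p"
  shows "\<bar>(t + p - 1)\<^sup>2 * (t + p - 2) * t\<bar> \<le> 1 / 4"
proof -
  define s where "s = t + p - 1"
  have s: "-1 \<le> s" "s \<le> 1" "\<bar>t\<bar> \<le> 1 + s" using p t by (auto simp: s_def)
  have "\<bar>(t + p - 1)\<^sup>2 * (t + p - 2) * t\<bar> = s\<^sup>2 * (1 - s) * \<bar>t\<bar>"
    using s by (simp add: abs_mult s_def)
  also have "\<dots> \<le> s\<^sup>2 * (1 - s) * (1 + s)" using s by (intro mult_left_mono) auto
  also have "\<dots> = s\<^sup>2 * (1 - s\<^sup>2)" by (simp add: power2_eq_square algebra_simps)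
  also have "\<dots> \<le> 1 / 4" by (rule mult_one_minus_le_quarter)
  finally show ?thesis .
qed

section \<open>A cyclic cubic form on the unit simplex, for \<open>G\<close> the square of the
  golden ratio\<close>

context
  fixes G :: real
  assumes G: "G\<^sup>2 = 3 * G - 1" "G > 1"
begin

lemma golden_square_bounds: "2.618 < G" "G < 2.6181" "G ^ 3 = 8 * G - 3"
proof -
  have sq: "(G - 3 / 2)\<^sup>2 = 5 / 4" using G(1) by (simp add: power2_eq_square algebra_simps)
  show "2.618 < G"
  proof (rule ccontr)
    assume "\<not> 2.618 < G"
    then have "\<bar>G - 3 / 2\<bar> \<le> 1.118" using G(2) by (intro abs_leI) auto
    then have "(G - 3 / 2)\<^sup>2 \<le> 1.118\<^sup>2" by (metis abs_ge_zero power2_abs power_mono)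
    then show False using sq by (simp add: power2_eq_square)
  qed
  show "G < 2.6181"
  proof (rule ccontr)
    assume "\<not> G < 2.6181"
    then have "1.1181 \<le> G - 3 / 2" by simp
    then have "1.1181\<^sup>2 \<le> (G - 3 / 2)\<^sup>2" by (intro power_mono) auto
    then show False using sq by (simp add: power2_eq_square)
  qed
  have "G ^ 3 = G * G\<^sup>2" by (simp add: power2_eq_square power3_eq_cube)
  also have "\<dots> = 3 * G\<^sup>2 - G" unfolding G(1) using G(1) by (simp add: algebra_simps power2_eq_square)
  also have "\<dots> = 8 * G - 3" by (simp add: G(1))
  finally show "G ^ 3 = 8 * G - 3" .
qed

text \<open>This sign pattern determines the constant. The estimates leave a quadratic in
  \<open>b\<close> with maximum G^3 / (4 (G + 1)), about 1.24; the rounder 7/5 is admissible because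
  its square is still below 2.\<close>

lemma cyclic_form_bound_one_negative:
  assumes abc: "a \<ge> 0" "b \<ge> 0" "c \<ge> 0" "a + b + c = 1"
    and s: "G * a - b \<ge> 0" "G * b - c \<ge> 0" "G * c - a \<le> 0"
  shows "\<bar>(G * a - b) * (G * b - c) * (G * c - a)\<bar> \<le> 7 / 5"
proof -
  have Gc: "G * c \<ge> 0" using G abc by simp
  have "G * a \<le> G * (1 - b)" using G abc by (intro mult_left_mono) auto
  then have x: "G * a - b \<le> G - (G + 1) * b" by (simp add: algebra_simps)
  have "\<bar>(G * a - b) * (G * b - c) * (G * c - a)\<bar> = (G * a - b) * (G * b - c) * (a - G * c)"
    using s by (simp add: abs_mult)
  also have "\<dots> \<le> (G - (G + 1) * b) * (G * b) * 1"
    using s abc Gc x by (intro mult_mono) auto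
  also have "\<dots> \<le> 7 / 5"
  proof -
    have "(G + 1) * (b * (G - (G + 1) * b)) = G\<^sup>2 / 4 - ((G + 1) * b - G / 2)\<^sup>2"
      by (simp add: power2_eq_square algebra_simps)
    also have "\<dots> \<le> G\<^sup>2 / 4" by simp
    finally have "(G + 1) * (b * (G - (G + 1) * b)) * G \<le> G\<^sup>2 / 4 * G"
      using G by (intro mult_right_mono) auto
    also have "\<dots> = (8 * G - 3) / 4" using golden_square_bounds(3) by (simp add: power2_eq_square power3_eq_cube)
    also have "\<dots> \<le> (G + 1) * (7 / 5)" using golden_square_bounds(2) by simp
    finally have "(G + 1) * ((G - (G + 1) * b) * (G * b)) \<le> (G + 1) * (7 / 5)"
      by (simp only: mult_ac)
    then show ?thesis unfolding mult_1_right by (rule mult_left_le_imp_le) (use G in simp)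
  qed
  finally show ?thesis .
qed

lemma cyclic_form_bound_two_negative:
  assumes abc: "a \<ge> 0" "b \<ge> 0" "c \<ge> 0" "a + b + c = 1"
    and s: "G * a - b \<le> 0" "G * b - c \<le> 0" "G * c - a \<ge> 0"
  shows "\<bar>(G * a - b) * (G * b - c) * (G * c - a)\<bar> \<le> 7 / 5"
proof -
  have G0: "G * a \<ge> 0" "G * b \<ge> 0" "G * c \<ge> 0" using G abc by auto
  have "\<bar>(G * a - b) * (G * b - c) * (G * c - a)\<bar> = (b - G * a) * (c - G * b) * (G * c - a)"
    using s by (simp add: abs_mult)
  also have "\<dots> \<le> b * c * (G * 1)"
  proof (intro mult_mono)
    have "G * c \<le> G * 1" using G abc by (intro mult_left_mono) auto
    then show "G * c - a \<le> G * 1" using abc by simp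
  qed (use s abc G0 in auto)
  also have "\<dots> \<le> 1 / 4 * (G * 1)"
  proof (rule mult_right_mono)
    have "b * c \<le> b * (1 - b)" using abc by (intro mult_left_mono) auto
    then show "b * c \<le> 1 / 4" using mult_one_minus_le_quarter[of b] by simp
  qed (use G in simp)
  also have "\<dots> \<le> 7 / 5" using golden_square_bounds by simp
  finally show ?thesis .
qed

text \<open>The three factors sum to G - 1 < 1.62. The product of two of them is at most a quarter
  of the squared sum, 0.6561, and the third is at most 1.62.\<close>

lemma cyclic_form_bound_none_negative:
  assumes abc: "a + b + c = 1"
    and s: "G * a - b \<ge> 0" "G * b - c \<ge> 0" "G * c - a \<ge> 0"
  shows "\<bar>(G * a - b) * (G * b - c) * (G * c - a)\<bar> \<le> 7 / 5"
proof -
  define x y z where "x = G * a - b" and "y = G * b - c" and "z = G * c - a"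
  have "x + y + z = (G - 1) * (a + b + c)" by (simp add: x_def y_def z_def algebra_simps)
  then have sum: "x + y + z \<le> 1.62" using abc golden_square_bounds by simp
  have nn: "x \<ge> 0" "y \<ge> 0" "z \<ge> 0" using s by (auto simp: x_def y_def z_def)
  have "4 * (x * y) = (x + y)\<^sup>2 - (x - y)\<^sup>2" by (simp add: power2_eq_square algebra_simps)
  also have "\<dots> \<le> (x + y)\<^sup>2" by simp
  also have "\<dots> \<le> 1.62\<^sup>2" using sum nn by (intro power_mono) auto
  finally have "x * y \<le> 0.6561" by (simp add: power2_eq_square)
  then have "x * y * z \<le> 0.6561 * 1.62" using sum nn by (intro mult_mono) auto
  then show ?thesis using nn by (simp add: x_def y_def z_def abs_mult)
qed

text \<open>The factors have positive sum (G - 1)(a + b + c), so they cannot all be nonpositive.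
  Cyclic symmetry reduces the remaining sign patterns to those with no, one or two nonpositive
  factors in a fixed position.\<close>

lemma cyclic_form_bound:
  assumes abc: "a \<ge> 0" "b \<ge> 0" "c \<ge> 0" "a + b + c = 1"
  shows "\<bar>(G * a - b) * (G * b - c) * (G * c - a)\<bar> \<le> 7 / 5"
proof -
  have "(G * a - b) + (G * b - c) + (G * c - a) = (G - 1) * (a + b + c)" by (simp add: algebra_simps)
  then have pos: "(G * a - b) + (G * b - c) + (G * c - a) > 0" using abc G by simp
  have rot: "b + c + a = 1" "c + a + b = 1" using abc by auto
  have comm: "(G * b - c) * (G * c - a) * (G * a - b) = (G * a - b) * (G * b - c) * (G * c - a)"
    "(G * c - a) * (G * a - b) * (G * b - c) = (G * a - b) * (G * b - c) * (G * c - a)"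
    by (simp_all add: mult_ac)
  consider "G * a - b \<ge> 0" "G * b - c \<ge> 0" "G * c - a \<ge> 0"
    | "G * a - b \<ge> 0" "G * b - c \<ge> 0" "G * c - a \<le> 0"
    | "G * b - c \<ge> 0" "G * c - a \<ge> 0" "G * a - b \<le> 0"
    | "G * c - a \<ge> 0" "G * a - b \<ge> 0" "G * b - c \<le> 0"
    | "G * a - b \<le> 0" "G * b - c \<le> 0" "G * c - a \<ge> 0"
    | "G * b - c \<le> 0" "G * c - a \<le> 0" "G * a - b \<ge> 0"
    | "G * c - a \<le> 0" "G * a - b \<le> 0" "G * b - c \<ge> 0"
    using pos by linarith
  then show ?thesis
  proof cases
    case 1 then show ?thesis using cyclic_form_bound_none_negative abc by blast
  next
    case 2 then show ?thesis using cyclic_form_bound_one_negative abc by blast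
  next
    case 3 then show ?thesis using cyclic_form_bound_one_negative[of b c a] abc rot comm by simp
  next
    case 4 then show ?thesis using cyclic_form_bound_one_negative[of c a b] abc rot comm by simp
  next
    case 5 then show ?thesis using cyclic_form_bound_two_negative abc by blast
  next
    case 6 then show ?thesis using cyclic_form_bound_two_negative[of b c a] abc rot comm by simp
  next
    case 7 then show ?thesis using cyclic_form_bound_two_negative[of c a b] abc rot comm by simp
  qed
qed

end

text \<open>The factor \<open>(3 - D)\<^sup>3 = D\<^sup>-\<^sup>3\<close> balances the two conjugates of \<open>D\<close>, which are inverse to each other:
  replacing \<open>D\<close> by its inverse reverses the orientation of the cyclic form and scales it.\<close>

lemma golden_form_bound:
  fixes D a b c :: real
  assumes D: "D\<^sup>2 = 3 * D - 1" and abc: "a \<ge> 0" "b \<ge> 0" "c \<ge> 0" "a + b + c = 1"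
  shows "((D * a - b) * (D * b - c) * (D * c - a))\<^sup>2 * (3 - D) ^ 3 \<le> 1 / 8"
proof -
  have inv: "D * (3 - D) = 1" using D by (simp add: power2_eq_square algebra_simps)
  have sq: "x\<^sup>2 \<le> 2" if "\<bar>x\<bar> \<le> 7 / 5" for x :: real
  proof -
    have "x\<^sup>2 \<le> (7 / 5)\<^sup>2" using that by (metis abs_ge_zero power2_abs power_mono)
    then show ?thesis by (simp add: power2_eq_square)
  qed
  show ?thesis
  proof (cases "D > 1")
    case True
    note Gb = golden_square_bounds[OF D True]
    have i3: "(3 - D) ^ 3 * D ^ 3 = 1" using inv by (simp flip: power_mult_distrib add: mult.commute)
    have "((D * a - b) * (D * b - c) * (D * c - a))\<^sup>2 \<le> 2"
      by (intro sq cyclic_form_bound[OF D True] abc)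
    \<comment> \<open>G^3 = 8 G - 3 is about 17.9, and 16 is what turns the bound 2 for the squared
      form into 1/8 times D^3.\<close>
    moreover have d3: "D ^ 3 \<ge> 16" using Gb by simp
    ultimately have "((D * a - b) * (D * b - c) * (D * c - a))\<^sup>2 \<le> 1 / 8 * D ^ 3" by simp
    moreover have "(3 - D) ^ 3 \<ge> 0" using Gb by simp
    ultimately have "((D * a - b) * (D * b - c) * (D * c - a))\<^sup>2 * (3 - D) ^ 3 \<le> 1 / 8 * D ^ 3 * (3 - D) ^ 3"
      by (rule mult_right_mono)
    also have "\<dots> = 1 / 8" using i3 by (simp add: mult.commute)
    finally show ?thesis .
  next
    case False
    define G where "G = 3 - D"
    have G: "G\<^sup>2 = 3 * G - 1" "G > 1"
      using D False by (auto simp: G_def power2_eq_square algebra_simps)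
    note Gb = golden_square_bounds[OF G]
    have DG: "D * G = 1" using inv by (simp add: G_def)
    have rev: "(D * a - b) * (D * b - c) * (D * c - a) * G ^ 3 = - ((G * b - a) * (G * a - c) * (G * c - b))"
    proof -
      have "(D * a - b) * (D * b - c) * (D * c - a) * G ^ 3 =
        (D * G * a - G * b) * (D * G * b - G * c) * (D * G * c - G * a)"
        by (simp add: power3_eq_cube algebra_simps)
      then show ?thesis by (simp add: DG algebra_simps)
    qed
    have "((G * b - a) * (G * a - c) * (G * c - b))\<^sup>2 \<le> 2"
      using abc by (intro sq cyclic_form_bound[OF G]) auto
    then have "((D * a - b) * (D * b - c) * (D * c - a) * G ^ 3)\<^sup>2 \<le> 2" by (simp add: rev)
    then have "((D * a - b) * (D * b - c) * (D * c - a))\<^sup>2 * G ^ 3 * G ^ 3 \<le> 2"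
      by (simp add: power_mult_distrib power2_eq_square mult_ac)
    moreover have "G ^ 3 \<ge> 16" using Gb by simp
    ultimately have "((D * a - b) * (D * b - c) * (D * c - a))\<^sup>2 * G ^ 3 * G ^ 3 \<le> 1 / 8 * G ^ 3"
      by simp
    then have "((D * a - b) * (D * b - c) * (D * c - a))\<^sup>2 * G ^ 3 \<le> 1 / 8"
      by (rule mult_right_le_imp_le) (use G in simp)
    then show ?thesis by (simp only: G_def)
  qed
qed

section \<open>The triangle when \<open>s\<close> or \<open>r\<close> is 5, in barycentric
  coordinates\<close>

context
  fixes D q t p :: real
  assumes D: "D\<^sup>2 = 3 * D - 1" and p: "0 \<le> p" "p \<le> 4"
    and t: "0 \<le> 4 * t + q * p" "4 * t + q * p \<le> D * (4 - p)"
begin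

lemma golden_conj_nonneg: "0 \<le> 3 - D"
proof -
  have "3 - D = (D - 2)\<^sup>2" using D by (simp add: power2_eq_square algebra_simps)
  then show ?thesis by simp
qed

text \<open>\<open>l0\<close>, \<open>l1\<close>, \<open>l2\<close> are the weights of the vertices
  (0, 0), (0, D) and (4, -q) in the (p, t) plane. Division by D is multiplication by 3 - D.\<close>

lemma golden_barycentric:
  obtains l0 l1 l2 where "l0 \<ge> 0" "l1 \<ge> 0" "l2 \<ge> 0" "l1 + l2 + l0 = 1" "p = 4 * l2" "t = D * l1 - q * l2"
proof -
  have inv: "D * (3 - D) = 1" using D by (simp add: power2_eq_square algebra_simps)
  have D3: "3 - D > 0" using inv golden_conj_nonneg by (metis mult_zero_right order_le_less zero_neq_one)
  define l1 where "l1 = (t + q * p / 4) * (3 - D)"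
  have "l1 \<ge> 0" using t D3 by (simp add: l1_def)
  moreover have "l1 \<le> 1 - p / 4"
  proof -
    have "l1 \<le> D * (1 - p / 4) * (3 - D)"
      unfolding l1_def using t D3 by (intro mult_right_mono) (auto simp: algebra_simps)
    also have "\<dots> = (1 - p / 4) * (D * (3 - D))" by (simp only: mult_ac)
    finally show ?thesis using inv by simp
  qed
  moreover have "D * l1 = (D * (3 - D)) * (t + q * p / 4)" unfolding l1_def by (simp only: mult_ac)
  then have "D * l1 = t + q * p / 4" using inv by simp
  ultimately show ?thesis using that[of "1 - l1 - p / 4" l1 "p / 4"] p by simp
qed

text \<open>The factors are, up to sign, D l1 - l2, D l2 - l0 and D l0 - l1: one line through each
  vertex, permuted cyclically. Their coefficients in t and p are integral because 1/D = 3 - D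
  is.\<close>

lemma bound_35:
  assumes "q = 1"
  shows "\<bar>(t * (t * (3 - D) + p - 1) * ((4 - D) * t + p - D))\<^sup>2 * (3 - D) ^ 3\<bar> \<le> 1 / 8"
proof -
  obtain l0 l1 l2 where l: "l0 \<ge> 0" "l1 \<ge> 0" "l2 \<ge> 0" "l1 + l2 + l0 = 1"
    and p': "p = 4 * l2" and t': "t = D * l1 - q * l2" by (rule golden_barycentric)
  have l0: "l0 = 1 - l1 - l2" using l(4) by simp
  have DD: "D * D = 3 * D - 1" using D by (simp add: power2_eq_square)
  \<comment> \<open>Equality holds only modulo the quadratic relation for D, so the difference is
    exhibited as a multiple of that relation.\<close>
  have "t * (3 - D) + p - 1 - (D * l2 - l0) = (3 * D - 1 - D * D) * l1"
    unfolding t' p' l0 assms by (simp add: algebra_simps)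
  then have y: "t * (3 - D) + p - 1 = D * l2 - l0" using DD by simp
  have "(4 - D) * t + p - D - (- (D * l0 - l1)) = (3 * D - 1 - D * D) * l1"
    unfolding t' p' l0 assms by (simp add: algebra_simps)
  then have z: "(4 - D) * t + p - D = - (D * l0 - l1)" using DD by simp
  have eq: "(t * (t * (3 - D) + p - 1) * ((4 - D) * t + p - D))\<^sup>2 * (3 - D) ^ 3 =
    ((D * l1 - l2) * (D * l2 - l0) * (D * l0 - l1))\<^sup>2 * (3 - D) ^ 3"
    unfolding y z by (simp add: t' assms power_mult_distrib del: minus_diff_eq)
  have "\<dots> \<le> 1 / 8" using l by (intro golden_form_bound[OF D]) auto
  then show ?thesis unfolding eq using golden_conj_nonneg by (subst abs_of_nonneg) auto
qed

text \<open>Here q is the conjugate-dependent value of \<open>a\<^sup>2\<close>, so the third vertex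
  moves with D. The factors are again the three cyclic lines, but with the opposite orientation, and
  the unit 3 - D is needed to normalise the first of them.\<close>

lemma bound_53:
  assumes "q = 3 - D"
  shows "\<bar>((3 - D) * (t + (1 - D) * p) * (t + p - D) * (1 - (4 - D) * t - (3 - D) * p))\<^sup>2 * (3 - D) ^ 3\<bar> \<le> 1 / 8"
proof -
  obtain l0 l1 l2 where l: "l0 \<ge> 0" "l1 \<ge> 0" "l2 \<ge> 0" "l1 + l2 + l0 = 1"
    and p': "p = 4 * l2" and t': "t = D * l1 - q * l2" by (rule golden_barycentric)
  have l0: "l0 = 1 - l1 - l2" using l(4) by simp
  have DD: "D * D = 3 * D - 1" using D by (simp add: power2_eq_square)
  have "(3 - D) * (t + (1 - D) * p) - (- (D * l2 - l1)) = (3 * D - 1 - D * D) * (l1 - 3 * l2)"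
    unfolding t' p' l0 assms by (simp add: algebra_simps)
  then have x: "(3 - D) * (t + (1 - D) * p) = - (D * l2 - l1)" using DD by simp
  have "t + p - D - (- (D * l0 - l2)) = 0"
    unfolding t' p' l0 assms by (simp add: algebra_simps)
  then have y: "t + p - D = - (D * l0 - l2)" using DD by simp
  have "1 - (4 - D) * t - (3 - D) * p - (- (D * l1 - l0)) = - ((3 * D - 1 - D * D) * (l1 + l2))"
    unfolding t' p' l0 assms by (simp add: algebra_simps)
  then have z: "1 - (4 - D) * t - (3 - D) * p = - (D * l1 - l0)" using DD by simp
  have eq: "((3 - D) * (t + (1 - D) * p) * (t + p - D) * (1 - (4 - D) * t - (3 - D) * p))\<^sup>2 * (3 - D) ^ 3 =
    ((D * l2 - l1) * (D * l1 - l0) * (D * l0 - l2))\<^sup>2 * (3 - D) ^ 3"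
    unfolding x y z by (simp add: power_mult_distrib mult_ac del: minus_diff_eq)
  have "\<dots> \<le> 1 / 8" using l by (intro golden_form_bound[OF D]) auto
  then show ?thesis unfolding eq using golden_conj_nonneg by (subst abs_of_nonneg) auto
qed

end

section \<open>The degree bounds\<close>

text \<open>From cos(3 pi/5) = - cos(2 pi/5), the multiple angle formulas give a cubic in cos(pi/5)
  with the factor x + 1, which positivity removes.\<close>

lemma two_cos_pi_div_5: "(2 * cos (pi / 5))\<^sup>2 = 2 * cos (pi / 5) + 1"
proof -
  let ?x = "cos (pi / 5)"
  have "cos (3 * (pi / 5)) = cos (pi - 2 * (pi / 5))" by (simp add: field_simps)
  also have "\<dots> = - cos (2 * (pi / 5))" by (rule cos_pi_minus)
  finally have "4 * ?x ^ 3 - 3 * ?x = - (2 * ?x\<^sup>2 - 1)"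
    unfolding cos_treble_cos cos_double_cos .
  then have "(?x + 1) * (4 * ?x\<^sup>2 - 2 * ?x - 1) = 0"
    by (simp add: power2_eq_square power3_eq_cube algebra_simps)
  moreover have "?x > 0" by (rule cos_gt_zero) auto
  ultimately have "4 * ?x\<^sup>2 - 2 * ?x - 1 = 0" by simp
  then show ?thesis by (simp add: power2_eq_square)
qed

lemma golden_ratio_bounds:
  fixes c :: real
  assumes "c\<^sup>2 = c + 1" "c > 0"
  shows "1.618 < c" "c < 1.6181"
proof -
  have "(c + 1)\<^sup>2 = 3 * (c + 1) - 1" using assms by (simp add: power2_eq_square algebra_simps)
  then show "1.618 < c" "c < 1.6181" using golden_square_bounds(1,2)[of "c + 1"] assms by auto
qed

lemma golden_ratio_conj_equation: "c\<^sup>2 = c + 1 \<Longrightarrow> (2 - c)\<^sup>2 = 3 * (2 - c) - 1" for c :: real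
  by (simp add: power2_eq_square algebra_simps)

lemma abs_mult_less_1I:
  fixes w :: real
  assumes "0 \<le> w" "w \<le> M" "M * \<kappa> < 1" "0 \<le> \<kappa>"
  shows "\<bar>w\<bar> * \<kappa> < 1"
proof -
  have "w * \<kappa> \<le> M * \<kappa>" using assms by (intro mult_right_mono) auto
  then show ?thesis using assms by simp
qed

section \<open>Size and nonvanishing of the integers at the identity embedding\<close>

lemma size_33:
  fixes t p :: real
  assumes t: "4 < t" "t \<le> 224" and p: "0 \<le> p" "p \<le> 4"
  defines "W \<equiv> (t * (t + p - 2))\<^sup>2 * (t * (t + p - 2) + 1)"
  shows "W \<noteq> 0 \<and> \<bar>W\<bar> * (4 / 27) ^ 20 < 1"
proof -
  let ?T = "t * (t + p - 2)"
  have T: "0 < ?T" using t p by (intro mult_pos_pos) auto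
  have "?T \<le> 224 * 226" using t p by (intro mult_mono) auto
  then have "W \<le> (224 * 226)\<^sup>2 * (224 * 226 + 1)"
    unfolding W_def using T t p by (intro mult_mono power_mono add_mono) auto
  then have "\<bar>W\<bar> * (4 / 27) ^ 20 < 1"
    by (rule abs_mult_less_1I[rotated]) (use T in \<open>simp_all add: W_def power_divide\<close>)
  moreover have "W > 0" unfolding W_def using T by (intro mult_pos_pos) auto
  ultimately show ?thesis by simp
qed

lemma size_43:
  fixes t p :: real
  assumes t: "4 < t" "t \<le> 252" and p: "0 \<le> p" "p \<le> 4"
  defines "W \<equiv> (t + p - 1)\<^sup>2 * (t + p - 2) * t"
  shows "W \<noteq> 0 \<and> \<bar>W\<bar> * (1 / 4) ^ 20 < 1"
proof -
  have W0: "W > 0" unfolding W_def using t p by (intro mult_pos_pos) auto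
  have "W \<le> 255\<^sup>2 * 254 * 252"
    unfolding W_def using t p by (intro mult_mono power_mono) auto
  then have "\<bar>W\<bar> * (1 / 4) ^ 20 < 1"
    by (rule abs_mult_less_1I[rotated]) (use W0 in \<open>simp_all add: power_divide\<close>)
  then show ?thesis using W0 by simp
qed

lemma size_35:
  fixes t p d :: real
  assumes t: "4 < t" "t \<le> 224" and p: "0 \<le> p" "p \<le> 4" and d: "0.3819 < d" "d < 0.382"
  defines "W \<equiv> (t * (t * (3 - d) + p - 1) * ((4 - d) * t + p - d))\<^sup>2 * (3 - d) ^ 3"
  shows "W \<noteq> 0 \<and> \<bar>W\<bar> * (1 / 8) ^ 20 < 1"
proof -
  have "4 * 2 \<le> t * (3 - d)" "t * (3 - d) \<le> 224 * 2.6181" using t d by (intro mult_mono; simp)+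
  then have y: "0 < t * (3 - d) + p - 1" "t * (3 - d) + p - 1 \<le> 590" using p by auto
  have "3 * 4 \<le> (4 - d) * t" "(4 - d) * t \<le> 3.6181 * 224" using t d by (intro mult_mono; simp)+
  then have z: "0 < (4 - d) * t + p - d" "(4 - d) * t + p - d \<le> 815" using p d by auto
  have W0: "W > 0" unfolding W_def using t y z d by (intro mult_pos_pos zero_less_power) auto
  have "W \<le> (224 * 590 * 815)\<^sup>2 * 2.7 ^ 3"
    unfolding W_def using t y z d by (intro mult_mono power_mono) auto
  then have "\<bar>W\<bar> * (1 / 8) ^ 20 < 1"
    by (rule abs_mult_less_1I[rotated]) (use W0 in \<open>simp_all add: power_divide\<close>)
  then show ?thesis using W0 by simp
qed

lemma size_53:
  fixes t p d :: real
  assumes t: "4 < t" "t \<le> 241.4" and p: "0 \<le> p" "p \<le> 4" and d: "0.3819 < d" "d < 0.382"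
  defines "W \<equiv> ((3 - d) * (t + (1 - d) * p) * (t + p - d) * (1 - (4 - d) * t - (3 - d) * p))\<^sup>2 * (3 - d) ^ 3"
  shows "W \<noteq> 0 \<and> \<bar>W\<bar> * (1 / 8) ^ 20 < 1"
proof -
  define x y z where "x = t + (1 - d) * p" and "y = t + p - d" and "z = (4 - d) * t + (3 - d) * p - 1"
  have "0 * 0 \<le> (1 - d) * p" "(1 - d) * p \<le> 0.6181 * 4" using p d by (intro mult_mono; simp)+
  then have x: "0 < x" "x \<le> 244" using t by (auto simp: x_def)
  have y: "0 < y" "y \<le> 246" using t p d by (auto simp: y_def)
  have "3 * 4 \<le> (4 - d) * t" "(4 - d) * t \<le> 3.6181 * 241.4" using t d by (intro mult_mono; simp)+
  moreover have "0 * 0 \<le> (3 - d) * p" "(3 - d) * p \<le> 2.6181 * 4" using p d by (intro mult_mono; simp)+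
  ultimately have z: "0 < z" "z \<le> 884" by (auto simp: z_def)
  have "1 - (4 - d) * t - (3 - d) * p = - z" by (simp add: z_def)
  then have W: "W = ((3 - d) * x * y * z)\<^sup>2 * (3 - d) ^ 3"
    unfolding W_def by (simp add: x_def y_def)
  have W0: "W > 0" unfolding W using x y z d by (intro mult_pos_pos zero_less_power) auto
  have "W \<le> (2.62 * 244 * 246 * 884)\<^sup>2 * 2.62 ^ 3"
    unfolding W using x y z d by (intro mult_mono power_mono) auto
  then have "\<bar>W\<bar> * (1 / 8) ^ 20 < 1"
    by (rule abs_mult_less_1I[rotated]) (use W0 in \<open>simp_all add: power_divide\<close>)
  then show ?thesis using W0 by simp
qed

context
  fixes u a b c :: real and A :: "real mat"
  assumes A_def: "A = mat 4 4 (\<lambda>(i,j).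
        if i = j then -2
        else if {i,j} = {0,1} then u
        else if {i,j} = {0,2} then a
        else if {i,j} = {1,2} then b
        else if {i,j} = {0,3} then c
        else 0)"
    and V: "V_arithmetic A" and u: "2 < u" "u < 14" and b: "0 \<le> b" "b \<le> 2"
begin

text \<open>The upper limits 224, 252 and 241.4 for t arise from m = 1, m = 2 and m = 1.6181, an
  upper bound for the golden ratio.\<close>

lemma edge_sum_bounds:
  assumes "0 \<le> a" "a \<le> m"
  shows "4 < u\<^sup>2 + u * a * b" "u\<^sup>2 + u * a * b \<le> 196 + 28 * m"
proof -
  have "2\<^sup>2 < u\<^sup>2" using u by (intro power_strict_mono) auto
  moreover have "u\<^sup>2 \<le> 14\<^sup>2" using u by (intro power_mono) auto
  moreover have "0 \<le> u * a * b" using u b assms by simp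
  moreover have "u * a * b \<le> 14 * m * 2" using u b assms by (intro mult_mono) auto
  ultimately show "4 < u\<^sup>2 + u * a * b" "u\<^sup>2 + u * a * b \<le> 196 + 28 * m" by auto
qed

lemma edge_square_bounds: "0 \<le> b\<^sup>2" "b\<^sup>2 \<le> 4"
  using power_mono[of b 2 2] b by auto

text \<open>This also serves s = 3, r = 4: there D = 1 instead of 2, and the smaller triangle lies
  inside the one for D = 2, so the same polynomial works.\<close>

lemma degree_bound_33:
  assumes a: "a = 1" and c: "c = 1 \<or> c\<^sup>2 = 2"
  shows "qfinite (ground_field A) \<and> qdegree (ground_field A) \<le> 20"
proof (rule ground_field_degree_bound[OF A_def V, where \<kappa> = "4 / 27"
      and W = "\<lambda>t p d. (t * (t + p - 2))\<^sup>2 * (t * (t + p - 2) + 1)"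
      and R = "\<lambda>a b c. a = 1 \<and> (c\<^sup>2 = 1 \<or> c\<^sup>2 = 2)"])
  show "int_polynomial (\<lambda>t p d. (t * (t + p - 2))\<^sup>2 * (t * (t + p - 2) + 1))"
    by (intro int_polynomial_intros)
next
  let ?t = "u\<^sup>2 + u * a * b" and ?p = "b\<^sup>2"
  have "4 < ?t" "?t \<le> 224" using edge_sum_bounds[of 1] a by auto
  note size = size_33[OF this edge_square_bounds]
  show "(?t * (?t + ?p - 2))\<^sup>2 * (?t * (?t + ?p - 2) + 1) \<noteq> 0"
    "\<bar>(?t * (?t + ?p - 2))\<^sup>2 * (?t * (?t + ?p - 2) + 1)\<bar> * (4 / 27) ^ 20 < 1"
    using size by blast+
next
  fix F and \<phi> :: "real \<Rightarrow> real"
  assume F: "is_subfield F" and hom: "hom_on F \<phi>" and "c \<in> F"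
  then show "\<phi> a = 1 \<and> ((\<phi> c)\<^sup>2 = 1 \<or> (\<phi> c)\<^sup>2 = 2)"
    using a c hom_on_1[OF F hom] hom_on_numeral[OF F hom] hom_on_power[OF F hom, of c 2] by auto
next
  fix u a b c :: real
  assume R: "a = 1 \<and> (c\<^sup>2 = 1 \<or> c\<^sup>2 = 2)" and p: "b\<^sup>2 < 4"
    and S: "(2 * u + a * b)\<^sup>2 < (4 - a\<^sup>2 - c\<^sup>2) * (4 - b\<^sup>2)"
  have "(4 - a\<^sup>2 - c\<^sup>2) * (4 - b\<^sup>2) \<le> 2 * (4 - b\<^sup>2)" using R p by (intro mult_right_mono) auto
  then show "\<bar>((u\<^sup>2 + u * a * b) * (u\<^sup>2 + u * a * b + b\<^sup>2 - 2))\<^sup>2 *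
      ((u\<^sup>2 + u * a * b) * (u\<^sup>2 + u * a * b + b\<^sup>2 - 2) + 1)\<bar> \<le> 4 / 27"
    using p R square_sum_bounds[OF S] by (intro bound_33) auto
qed auto

lemma degree_bound_43:
  assumes a: "a\<^sup>2 = 2" "a > 0" and c: "c = 1"
  shows "qfinite (ground_field A) \<and> qdegree (ground_field A) \<le> 20"
proof (rule ground_field_degree_bound[OF A_def V, where \<kappa> = "1 / 4"
      and W = "\<lambda>t p d. (t + p - 1)\<^sup>2 * (t + p - 2) * t"
      and R = "\<lambda>a b c. a\<^sup>2 = 2 \<and> c = 1"])
  show "int_polynomial (\<lambda>t p d. (t + p - 1)\<^sup>2 * (t + p - 2) * t)"
    by (intro int_polynomial_intros)
next
  let ?t = "u\<^sup>2 + u * a * b" and ?p = "b\<^sup>2"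
  have "a \<le> 2" by (rule power2_le_imp_le) (use a in simp_all)
  then have "4 < ?t" "?t \<le> 252" using edge_sum_bounds[of 2] a by auto
  note size = size_43[OF this edge_square_bounds]
  show "(?t + ?p - 1)\<^sup>2 * (?t + ?p - 2) * ?t \<noteq> 0"
    "\<bar>(?t + ?p - 1)\<^sup>2 * (?t + ?p - 2) * ?t\<bar> * (1 / 4) ^ 20 < 1"
    using size by blast+
next
  fix F and \<phi> :: "real \<Rightarrow> real"
  assume F: "is_subfield F" and hom: "hom_on F \<phi>" and "a \<in> F"
  then show "(\<phi> a)\<^sup>2 = 2 \<and> \<phi> c = 1"
    using a c hom_on_1[OF F hom] hom_on_numeral[OF F hom] hom_on_power[OF F hom, of a 2] by auto
next
  fix u a b c :: real
  assume R: "a\<^sup>2 = 2 \<and> c = 1" and p: "b\<^sup>2 < 4"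
    and S: "(2 * u + a * b)\<^sup>2 < (4 - a\<^sup>2 - c\<^sup>2) * (4 - b\<^sup>2)"
  show "\<bar>(u\<^sup>2 + u * a * b + b\<^sup>2 - 1)\<^sup>2 * (u\<^sup>2 + u * a * b + b\<^sup>2 - 2) * (u\<^sup>2 + u * a * b)\<bar> \<le> 1 / 4"
    using p R square_sum_bounds[OF S] by (intro bound_43) auto
qed auto

lemma degree_bound_35:
  assumes a: "a = 1" and c: "c\<^sup>2 = c + 1" "c > 0"
  shows "qfinite (ground_field A) \<and> qdegree (ground_field A) \<le> 20"
proof (rule ground_field_degree_bound[OF A_def V, where \<kappa> = "1 / 8"
      and W = "\<lambda>t p d. (t * (t * (3 - d) + p - 1) * ((4 - d) * t + p - d))\<^sup>2 * (3 - d) ^ 3"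
      and R = "\<lambda>a b c. a = 1 \<and> c\<^sup>2 = c + 1"])
  show "int_polynomial (\<lambda>t p d. (t * (t * (3 - d) + p - 1) * ((4 - d) * t + p - d))\<^sup>2 * (3 - d) ^ 3)"
    by (intro int_polynomial_intros)
next
  let ?t = "u\<^sup>2 + u * a * b" and ?p = "b\<^sup>2" and ?d = "4 - a\<^sup>2 - c\<^sup>2"
  let ?W = "(?t * (?t * (3 - ?d) + ?p - 1) * ((4 - ?d) * ?t + ?p - ?d))\<^sup>2 * (3 - ?d) ^ 3"
  have t: "4 < ?t" "?t \<le> 224" using edge_sum_bounds[of 1] a by auto
  have "?d = 2 - c" using a c by simp
  then have "0.3819 < ?d" "?d < 0.382" using golden_ratio_bounds[OF c] by auto
  note size = size_35[OF t edge_square_bounds this]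
  show "?W \<noteq> 0" "\<bar>?W\<bar> * (1 / 8) ^ 20 < 1" using size by blast+
next
  fix F and \<phi> :: "real \<Rightarrow> real"
  assume F: "is_subfield F" and hom: "hom_on F \<phi>" and "c \<in> F"
  then show "\<phi> a = 1 \<and> (\<phi> c)\<^sup>2 = \<phi> c + 1"
    using a c hom_on_1[OF F hom] hom_on_add[OF F hom, of c 1] subfield_1[OF F]
      hom_on_power[OF F hom, of c 2] by auto
next
  fix u a b c :: real
  assume R: "a = 1 \<and> c\<^sup>2 = c + 1" and p: "b\<^sup>2 < 4"
    and S: "(2 * u + a * b)\<^sup>2 < (4 - a\<^sup>2 - c\<^sup>2) * (4 - b\<^sup>2)"
  have d: "4 - a\<^sup>2 - c\<^sup>2 = 2 - c" using R by simp
  show "\<bar>((u\<^sup>2 + u * a * b) * ((u\<^sup>2 + u * a * b) * (3 - (4 - a\<^sup>2 - c\<^sup>2)) + b\<^sup>2 - 1) *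
      ((4 - (4 - a\<^sup>2 - c\<^sup>2)) * (u\<^sup>2 + u * a * b) + b\<^sup>2 - (4 - a\<^sup>2 - c\<^sup>2)))\<^sup>2 *
      (3 - (4 - a\<^sup>2 - c\<^sup>2)) ^ 3\<bar> \<le> 1 / 8"
    unfolding d using p R square_sum_bounds[OF S] d golden_ratio_conj_equation[of c]
    by (intro bound_35[of _ _ _ 1]) auto
qed auto

lemma degree_bound_53:
  assumes a: "a\<^sup>2 = a + 1" "a > 0" and c: "c = 1"
  shows "qfinite (ground_field A) \<and> qdegree (ground_field A) \<le> 20"
proof (rule ground_field_degree_bound[OF A_def V, where \<kappa> = "1 / 8"
      and W = "\<lambda>t p d. ((3 - d) * (t + (1 - d) * p) * (t + p - d) * (1 - (4 - d) * t - (3 - d) * p))\<^sup>2 * (3 - d) ^ 3"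
      and R = "\<lambda>a b c. a\<^sup>2 = a + 1 \<and> c = 1"])
  show "int_polynomial (\<lambda>t p d. ((3 - d) * (t + (1 - d) * p) * (t + p - d) * (1 - (4 - d) * t - (3 - d) * p))\<^sup>2 * (3 - d) ^ 3)"
    by (intro int_polynomial_intros)
next
  let ?t = "u\<^sup>2 + u * a * b" and ?p = "b\<^sup>2" and ?d = "4 - a\<^sup>2 - c\<^sup>2"
  let ?W = "((3 - ?d) * (?t + (1 - ?d) * ?p) * (?t + ?p - ?d) * (1 - (4 - ?d) * ?t - (3 - ?d) * ?p))\<^sup>2 * (3 - ?d) ^ 3"
  note ab = golden_ratio_bounds[OF a]
  have t: "4 < ?t" "?t \<le> 241.4" using edge_sum_bounds[of "1.6181"] ab a by auto
  have "?d = 2 - a" using a c by simp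
  then have "0.3819 < ?d" "?d < 0.382" using ab by auto
  note size = size_53[OF t edge_square_bounds this]
  show "?W \<noteq> 0" "\<bar>?W\<bar> * (1 / 8) ^ 20 < 1" using size by blast+
next
  fix F and \<phi> :: "real \<Rightarrow> real"
  assume F: "is_subfield F" and hom: "hom_on F \<phi>" and "a \<in> F"
  then show "(\<phi> a)\<^sup>2 = \<phi> a + 1 \<and> \<phi> c = 1"
    using a c hom_on_1[OF F hom] hom_on_add[OF F hom, of a 1] subfield_1[OF F]
      hom_on_power[OF F hom, of a 2] by auto
next
  fix u a b c :: real
  assume R: "a\<^sup>2 = a + 1 \<and> c = 1" and p: "b\<^sup>2 < 4"
    and S: "(2 * u + a * b)\<^sup>2 < (4 - a\<^sup>2 - c\<^sup>2) * (4 - b\<^sup>2)"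
  have d: "4 - a\<^sup>2 - c\<^sup>2 = 2 - a" using R by simp
  have q: "a\<^sup>2 = 3 - (2 - a)" using R by simp
  show "\<bar>((3 - (4 - a\<^sup>2 - c\<^sup>2)) * (u\<^sup>2 + u * a * b + (1 - (4 - a\<^sup>2 - c\<^sup>2)) * b\<^sup>2) *
      (u\<^sup>2 + u * a * b + b\<^sup>2 - (4 - a\<^sup>2 - c\<^sup>2)) *
      (1 - (4 - (4 - a\<^sup>2 - c\<^sup>2)) * (u\<^sup>2 + u * a * b) - (3 - (4 - a\<^sup>2 - c\<^sup>2)) * b\<^sup>2))\<^sup>2 *
      (3 - (4 - a\<^sup>2 - c\<^sup>2)) ^ 3\<bar> \<le> 1 / 8"
    unfolding d
  proof (rule bound_53[OF _ _ _ _ _ q])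
    show "(2 - a)\<^sup>2 = 3 * (2 - a) - 1" using R golden_ratio_conj_equation by blast
  qed (use p square_sum_bounds[OF S] d in auto)
qed auto

text \<open>With b = 0 and D = 2 every other embedding puts t in [0, 2], so y = (t - 1)^2 lies in
  [0, 1] and y (1 - y) \<le> 1/4. At the identity t \<le> 196, and 4^16 is the first power of 4
  above 195^2 (195^2 - 1).\<close>

lemma degree_bound_2_33:
  assumes b0: "b = 0" and a: "a = 1" and c: "c = 1"
  shows "qfinite (ground_field A) \<and> qdegree (ground_field A) \<le> 16"
proof (rule ground_field_degree_bound[OF A_def V, where \<kappa> = "1 / 4"
      and W = "\<lambda>t p d. (t - 1)\<^sup>2 * (1 - (t - 1)\<^sup>2)" and R = "\<lambda>a b c. b = 0 \<and> a = 1 \<and> c = 1"])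
  show "int_polynomial (\<lambda>t p d. (t - 1)\<^sup>2 * (1 - (t - 1)\<^sup>2))"
    by (intro int_polynomial_intros)
next
  let ?t = "u\<^sup>2 + u * a * b"
  let ?y = "(?t - 1)\<^sup>2"
  have t: "4 < ?t" "?t \<le> 196" using edge_sum_bounds[of 1] a u b0 power_mono[of u 14 2] by auto
  have y: "3\<^sup>2 < ?y" by (rule power_strict_mono) (use t in auto)
  have y': "?y \<le> 195\<^sup>2" by (rule power_mono) (use t in auto)
  from y show "?y * (1 - ?y) \<noteq> 0" by auto
  have "?y * (?y - 1) \<le> 195\<^sup>2 * (195\<^sup>2 - 1)" using y y' by (intro mult_mono) auto
  then have "\<bar>?y * (?y - 1)\<bar> * (1 / 4) ^ 16 < 1"
    by (rule abs_mult_less_1I[rotated]) (use y in \<open>simp_all add: power_divide\<close>)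
  then show "\<bar>?y * (1 - ?y)\<bar> * (1 / 4) ^ 16 < 1" by (simp only: abs_mult abs_minus_commute)
next
  fix F and \<phi> :: "real \<Rightarrow> real"
  assume F: "is_subfield F" and hom: "hom_on F \<phi>"
  then show "\<phi> b = 0 \<and> \<phi> a = 1 \<and> \<phi> c = 1"
    using a b0 c hom_on_0[OF F hom] hom_on_1[OF F hom] by auto
next
  fix u a b c :: real
  assume R: "b = 0 \<and> a = 1 \<and> c = 1" and S: "(2 * u + a * b)\<^sup>2 < (4 - a\<^sup>2 - c\<^sup>2) * (4 - b\<^sup>2)"
  have t: "u\<^sup>2 + u * a * b = u\<^sup>2" "u\<^sup>2 \<le> 2" using R square_sum_bounds[OF S] by auto
  have "\<bar>u\<^sup>2 - 1\<bar> \<le> 1" using t by (auto intro: abs_leI)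
  then have "(u\<^sup>2 - 1)\<^sup>2 \<le> 1" by (simp add: abs_square_le_1)
  then show "\<bar>(u\<^sup>2 + u * a * b - 1)\<^sup>2 * (1 - (u\<^sup>2 + u * a * b - 1)\<^sup>2)\<bar> \<le> 1 / 4"
    unfolding t(1) using mult_one_minus_le_quarter[of "(u\<^sup>2 - 1)\<^sup>2"] by (subst abs_of_nonneg) auto
qed auto

text \<open>Only \<open>a\<^sup>2 + c\<^sup>2\<close> enters when b = 0, so both orders of 3 and 4
  are covered. D = 1 confines t to [0, 1], and 4^8 is the first power of 4 above 196 * 195.\<close>

lemma degree_bound_2_34:
  assumes b0: "b = 0" and ac: "a\<^sup>2 + c\<^sup>2 = 3"
  shows "qfinite (ground_field A) \<and> qdegree (ground_field A) \<le> 8"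
proof (rule ground_field_degree_bound[OF A_def V, where \<kappa> = "1 / 4"
      and W = "\<lambda>t p d. t * (1 - t)" and R = "\<lambda>a b c. b = 0 \<and> a\<^sup>2 + c\<^sup>2 = 3"])
  show "int_polynomial (\<lambda>t p d. t * (1 - t))"
    by (intro int_polynomial_intros)
next
  let ?t = "u\<^sup>2 + u * a * b"
  have t: "4 < ?t" "?t \<le> 196"
    using u b0 power_mono[of u 14 2] power_strict_mono[of 2 u 2] by auto
  then show "?t * (1 - ?t) \<noteq> 0" by auto
  have "?t * (?t - 1) \<le> 196 * 195" using t by (intro mult_mono) auto
  then have "\<bar>?t * (?t - 1)\<bar> * (1 / 4) ^ 8 < 1"
    by (rule abs_mult_less_1I[rotated]) (use t in \<open>simp_all add: power_divide\<close>)
  then show "\<bar>?t * (1 - ?t)\<bar> * (1 / 4) ^ 8 < 1" by (simp only: abs_mult abs_minus_commute)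
next
  fix F and \<phi> :: "real \<Rightarrow> real"
  assume F: "is_subfield F" and hom: "hom_on F \<phi>" and m: "a \<in> F" "c \<in> F"
  have "(\<phi> a)\<^sup>2 + (\<phi> c)\<^sup>2 = \<phi> (a\<^sup>2 + c\<^sup>2)"
    using m by (simp add: hom_on_add[OF F hom] hom_on_power[OF F hom] subfield_power[OF F])
  then show "\<phi> b = 0 \<and> (\<phi> a)\<^sup>2 + (\<phi> c)\<^sup>2 = 3"
    using b0 ac hom_on_0[OF F hom] hom_on_numeral[OF F hom] by simp
next
  fix u a b c :: real
  assume R: "b = 0 \<and> a\<^sup>2 + c\<^sup>2 = 3" and S: "(2 * u + a * b)\<^sup>2 < (4 - a\<^sup>2 - c\<^sup>2) * (4 - b\<^sup>2)"
  have "4 - a\<^sup>2 - c\<^sup>2 = 1" using R by simp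
  then have t: "u\<^sup>2 + u * a * b = u\<^sup>2" "u\<^sup>2 \<le> 1" using R square_sum_bounds[OF S] by auto
  then show "\<bar>(u\<^sup>2 + u * a * b) * (1 - (u\<^sup>2 + u * a * b))\<bar> \<le> 1 / 4"
    unfolding t(1) using mult_one_minus_le_quarter[of "u\<^sup>2"] by (subst abs_of_nonneg) auto
qed auto

text \<open>When b = 0 only D matters, so \<open>R\<close> records its quadratic equation and both
  orders of 3 and 5 are covered. Multiplying t by 3 - D = 1/D scales the interval [0, D] to [0, 1]
  at either conjugate of D. At the identity the scaled value is at most 514, and 514 * 513 lies
  between 4^9 and 4^10.\<close>

lemma degree_bound_2_35:
  assumes b0: "b = 0" and ac: "a = 1 \<and> c\<^sup>2 = c + 1 \<and> c > 0 \<or> c = 1 \<and> a\<^sup>2 = a + 1 \<and> a > 0"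
  shows "qfinite (ground_field A) \<and> qdegree (ground_field A) \<le> 10"
proof (rule ground_field_degree_bound[OF A_def V, where \<kappa> = "1 / 4"
      and W = "\<lambda>t p d. t * (3 - d) * (1 - t * (3 - d))"
      and R = "\<lambda>a b c. b = 0 \<and> (4 - a\<^sup>2 - c\<^sup>2)\<^sup>2 = 3 * (4 - a\<^sup>2 - c\<^sup>2) - 1"])
  show "int_polynomial (\<lambda>t p d. t * (3 - d) * (1 - t * (3 - d)))"
    by (intro int_polynomial_intros)
next
  let ?t = "u\<^sup>2 + u * a * b" and ?d = "4 - a\<^sup>2 - c\<^sup>2"
  let ?g = "?t * (3 - ?d)"
  have t: "4 < ?t" "?t \<le> 196"
    using u b0 power_mono[of u 14 2] power_strict_mono[of 2 u 2] by auto
  have d: "2 < 3 - ?d" "3 - ?d \<le> 2.6181"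
    using ac golden_ratio_bounds[of a] golden_ratio_bounds[of c] by auto
  have g: "4 * 2 \<le> ?g" "?g \<le> 196 * 2.6181" using t d by (intro mult_mono; simp)+
  then show "?g * (1 - ?g) \<noteq> 0" by auto
  have "?g * (?g - 1) \<le> 514 * 513" using g by (intro mult_mono) auto
  then have "\<bar>?g * (?g - 1)\<bar> * (1 / 4) ^ 10 < 1"
    by (rule abs_mult_less_1I[rotated]) (use g in \<open>simp_all add: power_divide\<close>)
  then show "\<bar>?g * (1 - ?g)\<bar> * (1 / 4) ^ 10 < 1" by (simp only: abs_mult abs_minus_commute)
next
  fix F and \<phi> :: "real \<Rightarrow> real"
  assume F: "is_subfield F" and hom: "hom_on F \<phi>" and m: "a \<in> F" "c \<in> F"
  let ?d = "4 - a\<^sup>2 - c\<^sup>2"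
  have dF: "?d \<in> F" using m by (intro subfield_intros[OF F])
  have dd: "?d\<^sup>2 = 3 * ?d - 1" using ac golden_ratio_conj_equation[of a] golden_ratio_conj_equation[of c] by auto
  have "(\<phi> ?d)\<^sup>2 = \<phi> (?d\<^sup>2)" by (rule hom_on_power[OF F hom dF, symmetric])
  also have "\<dots> = \<phi> (3 * ?d) - \<phi> 1"
    unfolding dd using dF
    by (intro hom_on_diff[OF F hom] subfield_mult[OF F] subfield_numeral[OF F] subfield_1[OF F])
  also have "\<phi> (3 * ?d) = 3 * \<phi> ?d"
    using hom_on_mult[OF F hom subfield_numeral[OF F] dF] by (simp only: hom_on_numeral[OF F hom])
  also have "\<phi> 1 = 1" by (rule hom_on_1[OF F hom])
  finally have "(\<phi> ?d)\<^sup>2 = 3 * \<phi> ?d - 1" .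
  moreover have "\<phi> ?d = 4 - (\<phi> a)\<^sup>2 - (\<phi> c)\<^sup>2"
    using m by (simp add: hom_on_simps[OF F hom] subfield_intros[OF F])
  ultimately show "\<phi> b = 0 \<and> (4 - (\<phi> a)\<^sup>2 - (\<phi> c)\<^sup>2)\<^sup>2 = 3 * (4 - (\<phi> a)\<^sup>2 - (\<phi> c)\<^sup>2) - 1"
    using b0 hom_on_0[OF F hom] by simp
next
  fix u a b c :: real
  let ?d = "4 - a\<^sup>2 - c\<^sup>2"
  assume R: "b = 0 \<and> ?d\<^sup>2 = 3 * ?d - 1" and S: "(2 * u + a * b)\<^sup>2 < ?d * (4 - b\<^sup>2)"
  have t: "u\<^sup>2 + u * a * b = u\<^sup>2" "u\<^sup>2 \<le> ?d" using R square_sum_bounds[OF S] by auto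
  have "3 - ?d = (?d - 2)\<^sup>2" using R by (simp add: power2_eq_square algebra_simps)
  then have nn: "0 \<le> 3 - ?d" by simp
  have "u\<^sup>2 * (3 - ?d) \<le> ?d * (3 - ?d)" using t nn by (intro mult_right_mono)
  also have "\<dots> = 1" using R by (simp add: power2_eq_square algebra_simps)
  finally have "u\<^sup>2 * (3 - ?d) \<le> 1" .
  then show "\<bar>(u\<^sup>2 + u * a * b) * (3 - ?d) * (1 - (u\<^sup>2 + u * a * b) * (3 - ?d))\<bar> \<le> 1 / 4"
    unfolding t(1) using mult_one_minus_le_quarter[of "u\<^sup>2 * (3 - ?d)"] nn
    by (subst abs_of_nonneg) auto
qed auto

end

theorem theorem4p13:
  fixes k s r :: nat and u :: real and A :: "real mat" and K :: "real set"
  assumes "k \<ge> 2"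
    and "(s, r) \<in> {(3,3), (3,4), (3,5), (4,3), (5,3)}"
    and "alg_int u" and "totally_real (gen_field {u})"
    and "2 < u" and "u < 14"
    and A_def: "A = mat 4 4 (\<lambda>(i,j).
        if i = j then -2
        else if {i,j} = {0,1} then u
        else if {i,j} = {0,2} then 2 * cos (pi / real s)
        else if {i,j} = {1,2} then 2 * cos (pi / real k)
        else if {i,j} = {0,3} then 2 * cos (pi / real r)
        else 0)"
    and "V_arithmetic A"
    and K_def: "K = ground_field A"
  shows "qfinite K \<and>
    (k = 2 \<and> s = 3 \<and> r = 3 \<longrightarrow> qdegree K \<le> 16) \<and>
    (k = 2 \<and> (s, r) \<in> {(3,4), (4,3)} \<longrightarrow> qdegree K \<le> 8) \<and>
    (k = 2 \<and> (s, r) \<in> {(3,5), (5,3)} \<longrightarrow> qdegree K \<le> 10) \<and>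
    (r = 3 \<and> k = 3 \<longrightarrow> qdegree K \<le> 25) \<and>
    (r = 3 \<and> k = 7 \<longrightarrow> qdegree K \<le> 21) \<and>
    (k \<noteq> 2 \<and> \<not> (r = 3 \<and> k = 3) \<and> \<not> (r = 3 \<and> k = 7) \<longrightarrow> qdegree K \<le> 20) \<and>
    qdegree K \<le> 25"
proof -
  have k: "0 \<le> 2 * cos (pi / real k)" "2 * cos (pi / real k) \<le> 2"
  proof -
    have "pi / real k \<le> pi / 2" using assms(1) by (intro divide_left_mono) auto
    then show "0 \<le> 2 * cos (pi / real k)" by (simp add: cos_ge_zero order_trans[of _ 0])
  qed simp
  note hyps = A_def assms(8,5,6) k
  have c3: "2 * cos (pi / real 3) = 1" by (simp add: cos_60)
  have c4: "(2 * cos (pi / real 4))\<^sup>2 = 2" "2 * cos (pi / real 4) > 0"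
    by (simp_all add: cos_45 power2_eq_square)
  have c5: "(2 * cos (pi / real 5))\<^sup>2 = 2 * cos (pi / real 5) + 1" "2 * cos (pi / real 5) > 0"
    using two_cos_pi_div_5 cos_gt_zero[of "pi / 5"] by simp_all
  have k2: "2 * cos (pi / real k) = 0" if "k = 2" using that by simp
  consider "s = 3" "r = 3" | "s = 3" "r = 4" | "s = 3" "r = 5" | "s = 4" "r = 3" | "s = 5" "r = 3"
    using assms(2) by auto
  then show ?thesis
  proof cases
    case 1
    have "qfinite K \<and> qdegree K \<le> 20"
      unfolding K_def by (rule degree_bound_33[OF hyps]) (simp_all only: 1 c3 simp_thms)
    moreover have "qdegree K \<le> 16" if "k = 2"
      using degree_bound_2_33[OF hyps k2[OF that]] unfolding K_def by (simp only: 1 c3)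
    ultimately show ?thesis using 1 by auto
  next
    case 2
    have "qfinite K \<and> qdegree K \<le> 20"
      unfolding K_def by (rule degree_bound_33[OF hyps]) (simp_all only: 2 c3 c4 simp_thms)
    moreover have "qdegree K \<le> 8" if "k = 2"
    proof -
      have "(2 * cos (pi / real s))\<^sup>2 + (2 * cos (pi / real r))\<^sup>2 = 3" unfolding 2 c3 c4 by simp
      then show ?thesis using degree_bound_2_34[OF hyps k2[OF that]] by (simp only: K_def)
    qed
    ultimately show ?thesis using 2 by auto
  next
    case 3
    have "qfinite K \<and> qdegree K \<le> 20"
      unfolding K_def by (rule degree_bound_35[OF hyps]) (simp_all only: 3 c3 c5)
    moreover have "qdegree K \<le> 10" if "k = 2"
      using degree_bound_2_35[OF hyps k2[OF that]] c5 unfolding K_def by (simp only: 3 c3 simp_thms)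
    ultimately show ?thesis using 3 by auto
  next
    case 4
    have "qfinite K \<and> qdegree K \<le> 20"
      unfolding K_def by (rule degree_bound_43[OF hyps]) (simp_all only: 4 c3 c4)
    moreover have "qdegree K \<le> 8" if "k = 2"
    proof -
      have "(2 * cos (pi / real s))\<^sup>2 + (2 * cos (pi / real r))\<^sup>2 = 3" unfolding 4 c3 c4 by simp
      then show ?thesis using degree_bound_2_34[OF hyps k2[OF that]] by (simp only: K_def)
    qed
    ultimately show ?thesis using 4 by auto
  next
    case 5
    have "qfinite K \<and> qdegree K \<le> 20"
      unfolding K_def by (rule degree_bound_53[OF hyps]) (simp_all only: 5 c3 c5)
    moreover have "qdegree K \<le> 10" if "k = 2"
      using degree_bound_2_35[OF hyps k2[OF that]] c5 unfolding K_def by (simp only: 5 c3 simp_thms)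
    ultimately show ?thesis using 5 by auto
  qed
qed

end
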